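(* Let $p$ be a prime. Define $\mathrm{Tr}:M_2^k(\Gamma_0(p))\to M_2^k(K(p))$ as the restriction to $M_2^k(\Gamma_0(p))$ of the composite of Hecke operators $[B(p)\Gamma_0'(p)]:M_2^k(B(p))\to M_2^k(\Gamma_0'(p))$ followed by $[\Gamma_0'(p)K(p)]:M_2^k(\Gamma_0'(p))\to M_2^k(K(p))$. Then for every $f\in M_2^k(\Gamma_0(p))$, $$f|\mathrm{Tr}=\sum_{\beta\bmod p}f|t\begin{pmatrix}\beta/p&0\\0&0\end{pmatrix}+(f|E_1)|\tilde\mu+\sum_{\alpha,\beta\bmod p}(f|E_1)|t\begin{pmatrix}\beta/p&0\\0&\alpha\end{pmatrix}+\sum_{\alpha\bmod p}(f|F_p)|\mu\, t\begin{pmatrix}0&0\\0&\alpha\end{pmatrix}.$$ Furthermore $F_p\,\mathrm{Tr}=\mathrm{Tr}\,\mu$ as Hecke operators in $H(\Gamma_0(p),\mathrm{GSp}_2^+(\mathbb Q),K(p))$.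
   Context: $K(p)=\mathrm{Sp}_2(\mathbb Q)\cap\begin{pmatrix} * & * & */p & *\\ p* & * & * & *\\ p* & p* & * & p*\\ p* & * & * & *\end{pmatrix}$ ($*\in\mathbb Z$); $\Gamma_0'(p)=K(p)\cap\mathrm{Sp}_2(\mathbb Z)$; $\Gamma_0(p)=\{\begin{pmatrix}A&B\\C&D\end{pmatrix}\in\mathrm{Sp}_2(\mathbb Z):C\equiv0\bmod p\}$; $B(p)=\mathrm{Sp}_2(\mathbb Z)\cap\begin{pmatrix} * & * & * & *\\ p* & * & * & *\\ p* & p* & * & p*\\ p* & p* & * & *\end{pmatrix}$. $M_2^k(\Gamma)$ is the space of degree $2$ Siegel modular forms of weight $k$ for $\Gamma$. For $\gamma=\begin{pmatrix}A&B\\C&D\end{pmatrix}\in\mathrm{GSp}_2^+(\mathbb R)$ with multiplier $\mu(\gamma)$ ($\gamma'J\gamma=\mu(\gamma)J$), $(f|\gamma)(\Omega)=(f|_k\gamma)(\Omega)=\mu(\gamma)^{2k-3}\det(C\Omega+D)^{-k}f((A\Omega+B)(C\Omega+D)^{-1})$. For subgroups $G_1,G_2$ of $G=\mathrm{GSp}_2^+(\mathbb Q)$ commensurable with $\mathrm{Sp}_2(\mathbb Z)$, if $G_1gG_2=\bigsqcup_i G_1g_i$ then $[G_1gG_2]=\sum_iG_1g_i$ acts $M_2^k(G_1)\to M_2^k(G_2)$ by $f\mapsto\sum_if|_kg_i$; $H(G_1,G,G_2)$ is the space spanned by these, with product $(\sum_iG_1g_i)(\sum_jG_2h_j)=\sum_{i,j}G_1g_ih_j$;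 an element $w$ normalizing or single cosets $G_1w$ are written $w$. Notation: $t(S)=\begin{pmatrix}I_2&S\\0&I_2\end{pmatrix}$; $E_1=\begin{pmatrix}1&0&0&0\\0&0&0&1\\0&0&1&0\\0&-1&0&0\end{pmatrix}$; $F_p=\frac1{\sqrt p}\begin{pmatrix}0&I_2\\-pI_2&0\end{pmatrix}$; $\mu=\frac1{\sqrt p}\begin{pmatrix}0&1&0&0\\-p&0&0&0\\0&0&0&p\\0&0&-1&0\end{pmatrix}$; $\tilde\mu=\begin{pmatrix}0&1&0&0\\-p&0&0&0\\0&0&0&1\\0&0&-1/p&0\end{pmatrix}$.
   Formalization: Since F_p and μ contain 1/√p they are not in GSp_2^+(Q); the identity F_p Tr = Tr μ is stated in the Hecke space over positive real multiples of GSp_2^+(Q), and also for √p F_p and √p μ in H(Γ_0(p), GSp_2^+(Q), K(p)). *)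

theory Defs
  imports "HOL-Analysis.Analysis" "HOL-Computational_Algebra.Primes"
begin

type_synonym mat4 = "real^4^4"

definition mat_rows ::
    "'a::zero list list \<Rightarrow> (('a, 'n::{finite,one,plus}) vec, 'm::{finite,one,plus}) vec" where
  "mat_rows rs = vector (map vector rs)"


section \<open>Symplectic similitudes\<close>

definition Jmat :: mat4 where
  "Jmat = mat_rows
    [[ 0,  0, 1, 0],
     [ 0,  0, 0, 1],
     [-1,  0, 0, 0],
     [ 0, -1, 0, 0]]"

definition GSp2R :: "mat4 set" where
  "GSp2R = {\<gamma>. \<exists>m>0. transpose \<gamma> ** Jmat ** \<gamma> = m *\<^sub>R Jmat}"

definition multiplier :: "mat4 \<Rightarrow> real" where
  "multiplier \<gamma> = (THE m. transpose \<gamma> ** Jmat ** \<gamma> = m *\<^sub>R Jmat)"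

definition GSp2Q :: "mat4 set" where
  "GSp2Q = {\<gamma> \<in> GSp2R. \<forall>i j. \<gamma> $ i $ j \<in> \<rat>}"

definition Sp2Q :: "mat4 set" where
  "Sp2Q = {\<gamma>. transpose \<gamma> ** Jmat ** \<gamma> = Jmat \<and> (\<forall>i j. \<gamma> $ i $ j \<in> \<rat>)}"

definition Sp2Z :: "mat4 set" where
  "Sp2Z = {\<gamma>. transpose \<gamma> ** Jmat ** \<gamma> = Jmat \<and> (\<forall>i j. \<gamma> $ i $ j \<in> \<int>)}"

text \<open>Positive real multiples of rational similitudes. Matrices with an irrational
  normalising factor \<open>1 / sqrt p\<close>, such as \<open>F_mat p\<close> and \<open>mu_mat p\<close> below, lie in this
  group but not in \<open>GSp2Q\<close>.\<close>

definition GSp2Q_scaled :: "mat4 set" where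
  "GSp2Q_scaled = {c *\<^sub>R \<gamma> | c \<gamma>. c > 0 \<and> \<gamma> \<in> GSp2Q}"


section \<open>Congruence subgroups and the paramodular group\<close>

text \<open>Matrices whose \<open>(i,j)\<close> entry is an integral multiple of \<open>S $ i $ j\<close>.\<close>

definition entry_pattern :: "mat4 \<Rightarrow> mat4 set" where
  "entry_pattern S = {\<gamma>. \<forall>i j. \<exists>n::int. \<gamma> $ i $ j = S $ i $ j * of_int n}"

definition paramodular :: "nat \<Rightarrow> mat4 set" where
  "paramodular p = Sp2Q \<inter> entry_pattern (mat_rows
    [[     1,      1, 1 / real p,      1],
     [real p,      1,          1,      1],
     [real p, real p,          1, real p],
     [real p,      1,          1,      1]])"

definition Gamma0' :: "nat \<Rightarrow> mat4 set" where
  "Gamma0' p = paramodular p \<inter> Sp2Z"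

definition Gamma0 :: "nat \<Rightarrow> mat4 set" where
  "Gamma0 p = Sp2Z \<inter> entry_pattern (mat_rows
    [[     1,      1, 1, 1],
     [     1,      1, 1, 1],
     [real p, real p, 1, 1],
     [real p, real p, 1, 1]])"

definition Bgrp :: "nat \<Rightarrow> mat4 set" where
  "Bgrp p = Sp2Z \<inter> entry_pattern (mat_rows
    [[     1,      1, 1,      1],
     [real p,      1, 1,      1],
     [real p, real p, 1, real p],
     [real p, real p, 1,      1]])"


section \<open>Siegel modular forms of degree two\<close>

definition Im_mat :: "complex^2^2 \<Rightarrow> real^2^2" where
  "Im_mat \<Omega> = (\<chi> i j. Im (\<Omega> $ i $ j))"

definition H2 :: "(complex^2^2) set" where
  "H2 = {\<Omega>. transpose \<Omega> = \<Omega> \<and> (\<forall>x::real^2. x \<noteq> 0 \<longrightarrow> x \<bullet> (Im_mat \<Omega> *v x) > 0)}"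

definition upper_ix :: "2 \<Rightarrow> 4" where "upper_ix i = (if i = 1 then 1 else 2)"
definition lower_ix :: "2 \<Rightarrow> 4" where "lower_ix i = (if i = 1 then 3 else 4)"

definition blockA :: "mat4 \<Rightarrow> complex^2^2" where
  "blockA \<gamma> = (\<chi> i j. of_real (\<gamma> $ upper_ix i $ upper_ix j))"
definition blockB :: "mat4 \<Rightarrow> complex^2^2" where
  "blockB \<gamma> = (\<chi> i j. of_real (\<gamma> $ upper_ix i $ lower_ix j))"
definition blockC :: "mat4 \<Rightarrow> complex^2^2" where
  "blockC \<gamma> = (\<chi> i j. of_real (\<gamma> $ lower_ix i $ upper_ix j))"
definition blockD :: "mat4 \<Rightarrow> complex^2^2" where
  "blockD \<gamma> = (\<chi> i j. of_real (\<gamma> $ lower_ix i $ lower_ix j))"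

definition slash :: "int \<Rightarrow> (complex^2^2 \<Rightarrow> complex) \<Rightarrow> mat4 \<Rightarrow> complex^2^2 \<Rightarrow> complex" where
  "slash k f \<gamma> \<Omega> =
     of_real (multiplier \<gamma>) powi (2 * k - 3)
     * det (blockC \<gamma> ** \<Omega> + blockD \<gamma>) powi (- k)
     * f ((blockA \<gamma> ** \<Omega> + blockB \<gamma>) ** matrix_inv (blockC \<gamma> ** \<Omega> + blockD \<gamma>))"

text \<open>\<open>H2\<close> is open in the complex space of symmetric matrices, not in \<open>complex^2^2\<close>; hence
  the derivative is taken within \<open>H2\<close>, and only its values on symmetric matrices are
  determined by \<open>f\<close>. The matrix \<open>mat c ** Z\<close> is the scalar multiple of \<open>Z\<close> by \<open>c\<close>.\<close>

definition holomorphic_on_H2 :: "(complex^2^2 \<Rightarrow> complex) \<Rightarrow> bool" where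
  "holomorphic_on_H2 f \<longleftrightarrow>
     (\<forall>\<Omega>\<in>H2. \<exists>L. (f has_derivative L) (at \<Omega> within H2) \<and> (\<forall>c Z. L (mat c ** Z) = c * L Z))"

text \<open>No growth condition at the cusps is needed in degree two, by the Koecher principle.
  The values of \<open>f\<close> outside \<open>H2\<close> are irrelevant.\<close>

definition siegel_forms :: "int \<Rightarrow> mat4 set \<Rightarrow> (complex^2^2 \<Rightarrow> complex) set" where
  "siegel_forms k G =
     {f. holomorphic_on_H2 f \<and> (\<forall>\<gamma>\<in>G. \<forall>\<Omega>\<in>H2. slash k f \<gamma> \<Omega> = f \<Omega>)}"


section \<open>Hecke operators\<close>

text \<open>Formal linear combinations of cosets are represented by their coefficient functions.\<close>

type_synonym hecke = "mat4 set \<Rightarrow> complex"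

definition coset :: "mat4 set \<Rightarrow> mat4 \<Rightarrow> mat4 set" where
  "coset G g = {h ** g | h. h \<in> G}"

definition coset_rep :: "mat4 set \<Rightarrow> mat4" where
  "coset_rep c = (SOME g. g \<in> c)"

definition hecke_supp :: "hecke \<Rightarrow> mat4 set set" where
  "hecke_supp X = {c. X c \<noteq> 0}"

definition single_coset :: "mat4 set \<Rightarrow> mat4 \<Rightarrow> hecke" where
  "single_coset G w = (\<lambda>c. if c = coset G w then 1 else 0)"

text \<open>The sum of the distinct cosets \<open>coset G1 g\<^sub>i\<close> that make up the double coset of \<open>g\<close>.\<close>

definition double_coset :: "mat4 set \<Rightarrow> mat4 \<Rightarrow> mat4 set \<Rightarrow> hecke" where
  "double_coset G1 g G2 = (\<lambda>c. if \<exists>h1\<in>G1. \<exists>h2\<in>G2. c = coset G1 (h1 ** g ** h2) then 1 else 0)"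

definition hecke_space :: "mat4 set \<Rightarrow> mat4 set \<Rightarrow> mat4 set \<Rightarrow> hecke set" where
  "hecke_space G1 G G2 =
     {(\<lambda>c. \<Sum>g\<in>S. a g * double_coset G1 g G2 c) | S a. finite S \<and> S \<subseteq> G}"

text \<open>For a coset \<open>c\<close> of \<open>G1\<close> the set \<open>(\<lambda>x. x ** h) ` c\<close> is again a coset of \<open>G1\<close>.
  The product does not depend on the chosen representatives of the right factor, since the
  left factor is invariant under right translation by the middle group.\<close>

definition hecke_mult :: "hecke \<Rightarrow> hecke \<Rightarrow> hecke" where
  "hecke_mult X Y = (\<lambda>d. \<Sum>c\<in>hecke_supp X. \<Sum>e\<in>hecke_supp Y.
     X c * Y e * (if (\<lambda>x. x ** coset_rep e) ` c = d then 1 else 0))"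

definition hecke_act ::
    "int \<Rightarrow> (complex^2^2 \<Rightarrow> complex) \<Rightarrow> hecke \<Rightarrow> complex^2^2 \<Rightarrow> complex" where
  "hecke_act k f X = (\<lambda>\<Omega>. \<Sum>c\<in>hecke_supp X. X c * slash k f (coset_rep c) \<Omega>)"


section \<open>The particular matrices and the trace operator\<close>

definition t_mat :: "real^2^2 \<Rightarrow> mat4" where
  "t_mat S = mat_rows
    [[1, 0, S $ 1 $ 1, S $ 1 $ 2],
     [0, 1, S $ 2 $ 1, S $ 2 $ 2],
     [0, 0,         1,         0],
     [0, 0,         0,         1]]"

definition E1_mat :: mat4 where
  "E1_mat = mat_rows
    [[1,  0, 0, 0],
     [0,  0, 0, 1],
     [0,  0, 1, 0],
     [0, -1, 0, 0]]"

definition F_mat :: "nat \<Rightarrow> mat4" where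
  "F_mat p = (1 / sqrt (real p)) *\<^sub>R mat_rows
    [[       0,        0, 1, 0],
     [       0,        0, 0, 1],
     [- real p,        0, 0, 0],
     [       0, - real p, 0, 0]]"

definition mu_mat :: "nat \<Rightarrow> mat4" where
  "mu_mat p = (1 / sqrt (real p)) *\<^sub>R mat_rows
    [[       0, 1,  0,      0],
     [- real p, 0,  0,      0],
     [       0, 0,  0, real p],
     [       0, 0, -1,      0]]"

definition mu_tilde :: "nat \<Rightarrow> mat4" where
  "mu_tilde p = mat_rows
    [[       0, 1,            0, 0],
     [- real p, 0,            0, 0],
     [       0, 0,            0, 1],
     [       0, 0, - 1 / real p, 0]]"

definition Tr :: "int \<Rightarrow> nat \<Rightarrow> (complex^2^2 \<Rightarrow> complex) \<Rightarrow> complex^2^2 \<Rightarrow> complex" where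
  "Tr k p f = hecke_act k (hecke_act k f (double_coset (Bgrp p) (mat 1) (Gamma0' p)))
                (double_coset (Gamma0' p) (mat 1) (paramodular p))"

text \<open>The same operator as a formal sum of cosets of \<open>Gamma0 p\<close>. As \<open>Bgrp p \<subseteq> Gamma0 p\<close>,
  the first factor is the single coset \<open>Gamma0 p\<close>, which acts as the inclusion of the forms
  for \<open>Gamma0 p\<close> into those for \<open>Bgrp p\<close>.\<close>

definition Tr_hecke :: "nat \<Rightarrow> hecke" where
  "Tr_hecke p =
     hecke_mult (hecke_mult (double_coset (Gamma0 p) (mat 1) (Bgrp p))
                            (double_coset (Bgrp p) (mat 1) (Gamma0' p)))
                (double_coset (Gamma0' p) (mat 1) (paramodular p))"

end

theory Submission
  imports Defs
begin

text \<open>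
  Everything rests on \<open>\<Gamma>\<^sub>0(p) \<inter> K(p) = B(p)\<close>. It makes the products of representatives of
  \<open>B(p) \ \<Gamma>\<^sub>0'(p)\<close> and \<open>\<Gamma>\<^sub>0'(p) \ K(p)\<close> represent the cosets of \<open>\<Gamma>\<^sub>0(p)\<close> in \<open>\<Gamma>\<^sub>0(p) K(p)\<close>
  without repetition, so that \<open>Tr\<close> is the double coset of the identity. Both quotients are
  copies of the projective line over the field with \<open>p\<close> elements: the first is read off the
  indices 2 and 4, the second off the indices 1 and 3. The formula follows on choosing the
  representatives \<open>1\<close>, \<open>E\<^sub>1 t(0, \<alpha>)\<close> and \<open>w\<close>, \<open>t(\<beta>/p, 0)\<close>, because \<open>E\<^sub>1 \<mu>'\<close> (with \<open>\<mu>'\<close> for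
  \<open>mu_tilde\<close>) and \<open>F\<^sub>p \<mu>\<close> agree with \<open>w\<close> and \<open>E\<^sub>1 w\<close> up to a left factor in \<open>\<Gamma>\<^sub>0(p)\<close>. As \<open>F\<^sub>p\<close>
  normalizes \<open>\<Gamma>\<^sub>0(p)\<close> and \<open>\<mu>\<close> normalizes \<open>K(p)\<close>, the products \<open>F\<^sub>p Tr\<close> and \<open>Tr \<mu>\<close> are the double
  cosets of \<open>F\<^sub>p\<close> and \<open>\<mu>\<close>, which coincide by the same relation and \<open>\<mu>\<^sup>2 = -1\<close>.
\<close>

section \<open>Cosets of matrix groups\<close>

definition matrix_group :: "mat4 set \<Rightarrow> bool" where
  "matrix_group G \<longleftrightarrow> mat 1 \<in> G \<and> (\<forall>g\<in>G. \<forall>h\<in>G. g ** h \<in> G) \<and>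
     (\<forall>g\<in>G. \<exists>h\<in>G. h ** g = mat 1 \<and> g ** h = mat 1)"

lemma matrix_group_one: "matrix_group G \<Longrightarrow> mat 1 \<in> G"
  and matrix_group_mult: "matrix_group G \<Longrightarrow> g \<in> G \<Longrightarrow> h \<in> G \<Longrightarrow> g ** h \<in> G"
  by (auto simp: matrix_group_def)

lemma matrix_group_inverse:
  assumes "matrix_group G" "g \<in> G"
  obtains h where "h \<in> G" "h ** g = mat 1" "g ** h = mat 1"
  using assms by (auto simp: matrix_group_def)

lemma matrix_group_Int:
  assumes "matrix_group G" "matrix_group H"
  shows "matrix_group (G \<inter> H)"
proof -
  have "\<exists>h\<in>G \<inter> H. h ** g = mat 1 \<and> g ** h = mat 1" if g: "g \<in> G" "g \<in> H" for g
  proof -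
    obtain h where h: "h \<in> G" "h ** g = mat 1" "g ** h = mat 1"
      using matrix_group_inverse[OF assms(1) g(1)] .
    obtain h' where h': "h' \<in> H" "h' ** g = mat 1" "g ** h' = mat 1"
      using matrix_group_inverse[OF assms(2) g(2)] .
    have "h = h'"
      by (metis h(2) h'(3) matrix_mul_assoc matrix_mul_lid matrix_mul_rid)
    then show ?thesis using h h' by auto
  qed
  then show ?thesis using assms by (auto simp: matrix_group_def)
qed

lemma matrix_mult_right_cancel:
  fixes x y k l :: mat4
  assumes "k ** l = mat 1" "x ** k = y ** k"
  shows "x = y"
  by (metis assms matrix_mul_assoc matrix_mul_rid)

lemma coset_mult_right: "(\<lambda>x. x ** k) ` coset G g = coset G (g ** k)"
  by (force simp: coset_def matrix_mul_assoc)

lemma coset_eq_iff: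
  assumes "matrix_group G"
  shows "coset G x = coset G y \<longleftrightarrow> (\<exists>h\<in>G. x = h ** y)"
proof
  assume "coset G x = coset G y"
  moreover have "x \<in> coset G x"
    using matrix_group_one[OF assms] by (force simp: coset_def)
  ultimately show "\<exists>h\<in>G. x = h ** y" by (auto simp: coset_def)
next
  assume "\<exists>h\<in>G. x = h ** y"
  then obtain h where h: "h \<in> G" "x = h ** y" by auto
  obtain h' where h': "h' \<in> G" "h' ** h = mat 1" "h ** h' = mat 1"
    using matrix_group_inverse[OF assms h(1)] .
  have "y = h' ** x" using h h' by (simp add: matrix_mul_assoc)
  moreover have "coset G (g ** z) \<subseteq> coset G z" if "g \<in> G" for g z
    using that matrix_group_mult[OF assms] by (auto simp: coset_def matrix_mul_assoc)
  ultimately show "coset G x = coset G y" using h h' by (metis subset_antisym)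
qed

lemma coset_rep_coset:
  assumes "matrix_group G"
  obtains h where "h \<in> G" "coset_rep (coset G g) = h ** g"
proof -
  have "g \<in> coset G g"
    using matrix_group_one[OF assms] by (force simp: coset_def)
  then have "coset_rep (coset G g) \<in> coset G g"
    unfolding coset_rep_def by (rule someI)
  then show ?thesis using that by (auto simp: coset_def)
qed

lemma coset_coset_rep:
  assumes "matrix_group G"
  shows "coset G (coset_rep (coset G g)) = coset G g"
  using coset_rep_coset[OF assms, of g] coset_eq_iff[OF assms] by metis

text \<open>The left factor from \<open>G\<close> is absorbed by the coset, so only the right one
  matters. As the indicator function of a set of cosets, a double coset can be multiplied by
  counting.\<close>

lemma double_coset_eq:
  assumes "matrix_group G"
  shows "double_coset G g K = (\<lambda>c. of_bool (c \<in> (\<lambda>k. coset G (g ** k)) ` K))"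
proof -
  have "coset G (h ** g ** k) = coset G (g ** k)" if "h \<in> G" for h k
    using that by (auto simp: coset_eq_iff[OF assms] matrix_mul_assoc[symmetric])
  then show ?thesis
    using matrix_group_one[OF assms] by (auto simp: double_coset_def fun_eq_iff image_iff)
qed

lemma double_coset_one_eq:
  assumes "matrix_group G"
  shows "double_coset G (mat 1) K = (\<lambda>c. of_bool (c \<in> coset G ` K))"
  using double_coset_eq[OF assms, of "mat 1" K] by simp

section \<open>Products of multiplicity-free sums of cosets\<close>

lemma single_coset_eq: "single_coset G w = (\<lambda>c. of_bool (c \<in> {coset G w}))"
  by (auto simp: single_coset_def fun_eq_iff)

lemma hecke_supp_of_bool: "hecke_supp (\<lambda>c. of_bool (c \<in> S)) = S"
  by (auto simp: hecke_supp_def)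

text \<open>A coefficient of the product counts the pairs of cosets with the given product coset. If
  multiplying cosets is a bijection onto \<open>U\<close>, every count is 0 or 1. All Hecke products
  below are computed in this way.\<close>

lemma hecke_mult_of_bool:
  assumes "finite S" "finite T"
    and bij: "bij_betw (\<lambda>(c, e). (\<lambda>x. x ** coset_rep e) ` c) (S \<times> T) U"
  shows "hecke_mult (\<lambda>c. of_bool (c \<in> S)) (\<lambda>c. of_bool (c \<in> T)) = (\<lambda>c. of_bool (c \<in> U))"
proof
  fix d
  let ?m = "\<lambda>(c, e). (\<lambda>x::mat4. x ** coset_rep e) ` c"
  have "hecke_mult (\<lambda>c. of_bool (c \<in> S)) (\<lambda>c. of_bool (c \<in> T)) d =
      (\<Sum>z\<in>S \<times> T. of_bool (?m z = d))"
    by (auto simp: hecke_mult_def hecke_supp_of_bool sum.cartesian_product intro!: sum.cong)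
  also have "\<dots> = (\<Sum>u\<in>U. of_bool (u = d))"
    by (rule sum.reindex_bij_betw[OF bij])
  also have "\<dots> = of_bool (d \<in> U)"
    using bij_betw_finite[OF bij] assms(1,2) by (simp add: of_bool_def sum.delta)
  finally show "hecke_mult (\<lambda>c. of_bool (c \<in> S)) (\<lambda>c. of_bool (c \<in> T)) d = of_bool (d \<in> U)" .
qed

text \<open>An equality of products \<open>h ** r = a ** (h' ** r')\<close> with \<open>a\<close> in
  \<open>A\<close> forces \<open>a\<close> into \<open>A \<inter> K\<close>, hence into
  \<open>H\<close>. Then \<open>r\<close> and \<open>r'\<close> represent the same coset of
  \<open>H\<close>, so no coset of \<open>A\<close> is hit twice.\<close>

lemma hecke_mult_double_coset_one:
  assumes A: "matrix_group A" and H: "matrix_group H" and K: "matrix_group K"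
    and "H \<subseteq> K" "A \<inter> K \<subseteq> H"
    and fin: "finite (coset A ` H)" "finite (coset H ` K)"
  shows "hecke_mult (double_coset A (mat 1) H) (double_coset H (mat 1) K) = double_coset A (mat 1) K"
  unfolding double_coset_one_eq[OF A] double_coset_one_eq[OF H]
proof (rule hecke_mult_of_bool[OF fin])
  let ?m = "\<lambda>(c, e). (\<lambda>x::mat4. x ** coset_rep e) ` c"
  have rep: "\<exists>h\<in>H. coset_rep (coset H k) = h ** k" for k
    using coset_rep_coset[OF H] by metis
  show "bij_betw ?m (coset A ` H \<times> coset H ` K) (coset A ` K)"
  proof (rule bij_betwI')
    fix z z' assume "z \<in> coset A ` H \<times> coset H ` K" "z' \<in> coset A ` H \<times> coset H ` K"
    then obtain h k h' k' where hk: "z = (coset A h, coset H k)" "z' = (coset A h', coset H k')"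
      "h \<in> H" "h' \<in> H" "k \<in> K" "k' \<in> K" by blast
    define r r' where "r = coset_rep (coset H k)" and "r' = coset_rep (coset H k')"
    have rK: "r \<in> K" "r' \<in> K"
      using rep[of k] rep[of k'] hk assms(4) matrix_group_mult[OF K] unfolding r_def r'_def by auto
    have rc: "coset H r = coset H k" "coset H r' = coset H k'"
      by (simp_all add: r_def r'_def coset_coset_rep[OF H])
    show "(?m z = ?m z') = (z = z')"
    proof
      assume "?m z = ?m z'"
      then have "coset A (h ** r) = coset A (h' ** r')"
        by (simp add: hk coset_mult_right r_def r'_def)
      then obtain a where a: "a \<in> A" "h ** r = a ** (h' ** r')"
        by (auto simp: coset_eq_iff[OF A])
      obtain q where q: "q \<in> K" "h' ** r' ** q = mat 1"
        using matrix_group_inverse[OF K] matrix_group_mult[OF K] hk rK assms(4) by (metis subsetD)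
      have "a = h ** r ** q" using a q by (metis matrix_mul_assoc matrix_mul_rid)
      then have "a \<in> K" using hk rK q assms(4) by (auto intro!: matrix_group_mult[OF K])
      then have aH: "a \<in> H" using a assms(5) by auto
      obtain i where i: "i \<in> H" "i ** h = mat 1" using matrix_group_inverse[OF H hk(3)] by metis
      have "r = (i ** a ** h') ** r'"
        using arg_cong[OF a(2), of "(**) i"] by (simp add: i(2) matrix_mul_assoc)
      moreover have "i ** a ** h' \<in> H" using i aH hk by (auto intro!: matrix_group_mult[OF H])
      ultimately have "coset H r = coset H r'" by (auto simp: coset_eq_iff[OF H])
      \<comment> \<open>Equal cosets have the same chosen representative, so \<open>r\<close> can be
        cancelled to compare \<open>h\<close> with \<open>h'\<close>.\<close>
      then have e: "coset H k = coset H k'" using rc by simp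
      then have "r = r'" by (simp add: r_def r'_def)
      obtain s where "r ** s = mat 1" using matrix_group_inverse[OF K rK(1)] by metis
      then have "h = a ** h'"
        using a(2) \<open>r = r'\<close> matrix_mult_right_cancel[of r s h "a ** h'"] by (simp add: matrix_mul_assoc)
      then show "z = z'" using e a(1) by (auto simp: hk coset_eq_iff[OF A])
    qed simp
  next
    fix z assume "z \<in> coset A ` H \<times> coset H ` K"
    then obtain h k where hk: "z = (coset A h, coset H k)" "h \<in> H" "k \<in> K" by blast
    then have "h ** coset_rep (coset H k) \<in> K"
      using rep[of k] assms(4) by (auto intro!: matrix_group_mult[OF K])
    then show "?m z \<in> coset A ` K" by (auto simp: hk coset_mult_right)
  next
    fix y assume "y \<in> coset A ` K"
    then obtain k where k: "k \<in> K" "y = coset A k" by auto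
    obtain h where h: "h \<in> H" "k = h ** coset_rep (coset H k)"
      using coset_coset_rep[OF H, of k] by (metis coset_eq_iff[OF H])
    then have "?m (coset A h, coset H k) = y" by (simp add: coset_mult_right k(2))
    then show "\<exists>z\<in>coset A ` H \<times> coset H ` K. y = ?m z"
      using h(1) k(1) by (intro bexI[of _ "(coset A h, coset H k)"]) auto
  qed
qed

section \<open>Multiplication by normalizing elements\<close>

definition normalizes :: "mat4 \<Rightarrow> mat4 set \<Rightarrow> bool" where
  "normalizes x G \<longleftrightarrow> (\<exists>y. x ** y = mat 1 \<and> y ** x = mat 1 \<and>
     (\<forall>g\<in>G. x ** g ** y \<in> G \<and> y ** g ** x \<in> G))"

text \<open>Stability under both conjugations gives both inclusions of \<open>x G = G x\<close>; for
  an infinite group one does not imply the other. Here \<open>x\<close> may be any invertible real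
  matrix, which admits the factor 1 / sqrt p in \<open>F_mat\<close> and
  \<open>mu_mat\<close>.\<close>

lemma normalizesE:
  assumes "normalizes x G"
  obtains y where "x ** y = mat 1" "y ** x = mat 1"
    "\<And>g. g \<in> G \<Longrightarrow> \<exists>g'\<in>G. x ** g = g' ** x" "\<And>g. g \<in> G \<Longrightarrow> \<exists>g'\<in>G. g ** x = x ** g'"
proof -
  obtain y where y: "x ** y = mat 1" "y ** x = mat 1"
    "\<And>g. g \<in> G \<Longrightarrow> x ** g ** y \<in> G" "\<And>g. g \<in> G \<Longrightarrow> y ** g ** x \<in> G"
    using assms by (auto simp: normalizes_def)
  have "x ** g = (x ** g ** y) ** x" "g ** x = x ** (y ** g ** x)" for g
    by (metis y(1,2) matrix_mul_assoc matrix_mul_lid matrix_mul_rid)+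
  then show ?thesis using that y by metis
qed

text \<open>Conjugation does not see scalars. This transfers the results for \<open>F_mat\<close>
  and \<open>mu_mat\<close> to their multiples by sqrt p, which have rational entries.\<close>

lemma normalizes_scaleR:
  assumes "normalizes x G" "c \<noteq> 0"
  shows "normalizes (c *\<^sub>R x) G"
proof -
  obtain y where y: "x ** y = mat 1" "y ** x = mat 1"
    "\<forall>g\<in>G. x ** g ** y \<in> G \<and> y ** g ** x \<in> G"
    using assms(1) by (auto simp: normalizes_def)
  then show ?thesis
    unfolding normalizes_def using assms(2)
    by (intro exI[of _ "inverse c *\<^sub>R y"]) (simp add: matrix_scalar_ac scalar_matrix_assoc[symmetric])
qed

text \<open>Moving \<open>x\<close> across \<open>A\<close> gives \<open>(A x)(A k) = A x k\<close>,
  whichever representative of \<open>A k\<close> is chosen; moving it back shows that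
  \<open>A x k\<close> determines \<open>A k\<close>.\<close>

lemma hecke_mult_single_coset_left:
  assumes A: "matrix_group A" and x: "normalizes x A" and fin: "finite (coset A ` K)"
  shows "hecke_mult (single_coset A x) (double_coset A (mat 1) K) = double_coset A x K"
  unfolding double_coset_one_eq[OF A] double_coset_eq[OF A, of x] single_coset_eq
proof (rule hecke_mult_of_bool[OF _ fin])
  obtain y where y: "x ** y = mat 1" "y ** x = mat 1"
    "\<And>g. g \<in> A \<Longrightarrow> \<exists>g'\<in>A. x ** g = g' ** x" "\<And>g. g \<in> A \<Longrightarrow> \<exists>g'\<in>A. g ** x = x ** g'"
    using normalizesE[OF x] by blast
  have m: "(\<lambda>z. z ** coset_rep (coset A k)) ` coset A x = coset A (x ** k)" for k
  proof -
    obtain a where a: "a \<in> A" "coset_rep (coset A k) = a ** k" using coset_rep_coset[OF A] by metis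
    obtain a' where "a' \<in> A" "x ** a = a' ** x" using y(3) a by blast
    then have "x ** coset_rep (coset A k) = a' ** (x ** k)" by (simp add: a matrix_mul_assoc)
    then show ?thesis using \<open>a' \<in> A\<close> by (auto simp: coset_mult_right coset_eq_iff[OF A])
  qed
  have inj: "coset A k = coset A k'" if eq: "coset A (x ** k) = coset A (x ** k')" for k k'
  proof -
    obtain a where a: "a \<in> A" "x ** k = a ** (x ** k')" using eq by (auto simp: coset_eq_iff[OF A])
    obtain a' where a': "a' \<in> A" "a ** x = x ** a'" using y(4) a by blast
    have "x ** k = x ** (a' ** k')" using a a' by (metis matrix_mul_assoc)
    then have "k = a' ** k'" by (metis y(2) matrix_mul_assoc matrix_mul_lid)
    then show ?thesis using a' by (auto simp: coset_eq_iff[OF A])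
  qed
  have "inj_on (\<lambda>(c, e). (\<lambda>z. z ** coset_rep e) ` c) ({coset A x} \<times> coset A ` K)"
    by (rule inj_onI) (clarsimp simp: m, erule inj)
  moreover have "(\<lambda>(c, e). (\<lambda>z. z ** coset_rep e) ` c) ` ({coset A x} \<times> coset A ` K)
      = (\<lambda>k. coset A (x ** k)) ` K"
  proof -
    have "{coset A x} \<times> coset A ` K = (\<lambda>k. (coset A x, coset A k)) ` K" by auto
    then show ?thesis by (simp add: image_image m)
  qed
  ultimately show "bij_betw (\<lambda>(c, e). (\<lambda>z. z ** coset_rep e) ` c) ({coset A x} \<times> coset A ` K)
      ((\<lambda>k. coset A (x ** k)) ` K)"
    by (simp add: bij_betw_def)
qed simp

text \<open>The chosen representative of \<open>K x\<close> is \<open>r ** x\<close> with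
  \<open>r\<close> in \<open>K\<close>, so the products are the cosets \<open>A k r x\<close>. They
  stay distinct because \<open>r ** x\<close> is invertible, and \<open>K x = x K\<close> turns them
  into the cosets that make up \<open>A x K\<close>.\<close>

lemma hecke_mult_single_coset_right:
  assumes A: "matrix_group A" and K: "matrix_group K" and x: "normalizes x K"
    and fin: "finite (coset A ` K)"
  shows "hecke_mult (double_coset A (mat 1) K) (single_coset K x) = double_coset A x K"
  unfolding double_coset_one_eq[OF A] double_coset_eq[OF A, of x] single_coset_eq
proof (rule hecke_mult_of_bool[OF fin])
  obtain y where y: "x ** y = mat 1" "y ** x = mat 1"
    "\<And>g. g \<in> K \<Longrightarrow> \<exists>g'\<in>K. x ** g = g' ** x" "\<And>g. g \<in> K \<Longrightarrow> \<exists>g'\<in>K. g ** x = x ** g'"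
    using normalizesE[OF x] by blast
  obtain r where r: "r \<in> K" "coset_rep (coset K x) = r ** x" using coset_rep_coset[OF K] by metis
  obtain s where s: "s \<in> K" "s ** r = mat 1" "r ** s = mat 1" using matrix_group_inverse[OF K r(1)] .
  have m: "(\<lambda>z. z ** coset_rep (coset K x)) ` coset A k = coset A (k ** r ** x)" for k
    unfolding r coset_mult_right by (simp add: matrix_mul_assoc)
  have inj: "coset A k = coset A k'" if eq: "coset A (k ** r ** x) = coset A (k' ** r ** x)" for k k'
  proof -
    obtain a where a: "a \<in> A" "k ** r ** x = a ** (k' ** r ** x)"
      using eq by (auto simp: coset_eq_iff[OF A])
    have "k ** r ** x = (a ** k') ** r ** x" using a by (simp add: matrix_mul_assoc)
    then have "k ** r = (a ** k') ** r" using matrix_mult_right_cancel[OF y(1)] by blast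
    then have "k = a ** k'" using matrix_mult_right_cancel[OF s(3)] by blast
    then show ?thesis using a by (auto simp: coset_eq_iff[OF A])
  qed
  have "inj_on (\<lambda>(c, e). (\<lambda>z. z ** coset_rep e) ` c) (coset A ` K \<times> {coset K x})"
    by (rule inj_onI) (clarsimp simp: m, erule inj)
  moreover have "coset A (x ** k) \<in> (\<lambda>k. coset A (k ** r ** x)) ` K" if k: "k \<in> K" for k
  proof -
    obtain k' where k': "k' \<in> K" "x ** k = k' ** x" using y(3) k by blast
    \<comment> \<open>The uncontrolled factor \<open>r\<close> is compensated by its inverse
      \<open>s\<close>.\<close>
    have "x ** k = k' ** s ** r ** x" using k' s by (metis matrix_mul_assoc matrix_mul_rid)
    then show ?thesis using matrix_group_mult[OF K k'(1) s(1)] by auto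
  qed
  moreover have "coset A (k ** r ** x) \<in> (\<lambda>k. coset A (x ** k)) ` K" if k: "k \<in> K" for k
    using y(4)[OF matrix_group_mult[OF K k r(1)]] by auto
  moreover have "(\<lambda>(c, e). (\<lambda>z. z ** coset_rep e) ` c) ` (coset A ` K \<times> {coset K x})
      = (\<lambda>k. coset A (k ** r ** x)) ` K"
  proof -
    have "coset A ` K \<times> {coset K x} = (\<lambda>k. (coset A k, coset K x)) ` K" by auto
    then show ?thesis by (simp add: image_image m)
  qed
  ultimately show "bij_betw (\<lambda>(c, e). (\<lambda>z. z ** coset_rep e) ` c) (coset A ` K \<times> {coset K x})
      ((\<lambda>k. coset A (x ** k)) ` K)"
    unfolding bij_betw_def by (intro conjI equalityI) auto
qed simp

text \<open>Turns a relation between \<open>F_mat\<close> and \<open>mu_mat\<close> up to factors in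
  the two groups into an equality of double cosets.\<close>

lemma double_coset_cong:
  assumes A: "matrix_group A" and K: "matrix_group K" and "a \<in> A" "k \<in> K"
  shows "double_coset A (a ** x ** k) K = double_coset A x K"
proof -
  have c: "coset A (a ** x ** k ** k') = coset A (x ** (k ** k'))" for k'
    using assms(3) by (auto simp: coset_eq_iff[OF A] matrix_mul_assoc[symmetric])
  obtain s where s: "s \<in> K" "k ** s = mat 1" using matrix_group_inverse[OF K assms(4)] by metis
  have "(\<lambda>k'. coset A (x ** (k ** k'))) ` K = (\<lambda>k. coset A (x ** k)) ` K"
  proof (intro equalityI subsetI; elim imageE)
    fix y k' assume k': "y = coset A (x ** k')" "k' \<in> K"
    have "k' = k ** (s ** k')" using s by (simp add: matrix_mul_assoc)
    then show "y \<in> (\<lambda>k'. coset A (x ** (k ** k'))) ` K"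
      using k' matrix_group_mult[OF K s(1)] by (auto intro!: image_eqI[of _ _ "s ** k'"])
  qed (use matrix_group_mult[OF K assms(4)] in auto)
  then show ?thesis by (simp add: double_coset_eq[OF A] c)
qed

lemma double_coset_in_hecke_space: "g \<in> G \<Longrightarrow> double_coset G1 g G2 \<in> hecke_space G1 G G2"
  unfolding hecke_space_def by (intro CollectI exI[of _ "{g}"] exI[of _ "\<lambda>_. 1"]) auto

text \<open>Since \<open>A \<inter> K\<close> lies in \<open>B\<close>, two elements of
  \<open>K\<close> share a coset of \<open>A\<close> only if they share a coset of \<open>B\<close>.
  The usual products of representatives along \<open>B \<subseteq> H \<subseteq> K\<close> therefore
  also enumerate the cosets of \<open>A\<close> met by \<open>K\<close>.\<close>

lemma bij_betw_coset_tower: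
  assumes A: "matrix_group A" and B: "matrix_group B" and H: "matrix_group H" and K: "matrix_group K"
    and "B \<subseteq> A" "B \<subseteq> H" "H \<subseteq> K" "A \<inter> K \<subseteq> B"
    and r: "bij_betw (\<lambda>i. coset B (r i)) I (coset B ` H)" "\<And>i. r i \<in> H"
    and s: "bij_betw (\<lambda>j. coset H (s j)) J (coset H ` K)" "\<And>j. s j \<in> K"
  shows "bij_betw (\<lambda>(j, i). coset A (r i ** s j)) (J \<times> I) (coset A ` K)"
proof (rule bij_betw_imageI)
  show "inj_on (\<lambda>(j, i). coset A (r i ** s j)) (J \<times> I)"
  proof (rule inj_onI, clarify)
    fix j i j' i'
    assume ij: "i \<in> I" "j \<in> J" "i' \<in> I" "j' \<in> J" "coset A (r i ** s j) = coset A (r i' ** s j')"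
    obtain a where a: "a \<in> A" "r i ** s j = a ** (r i' ** s j')"
      using ij(5) by (auto simp: coset_eq_iff[OF A])
    have rs: "r i ** s j \<in> K" "r i' ** s j' \<in> K" for i j
      using r(2) s(2) assms(7) by (auto intro!: matrix_group_mult[OF K])
    obtain q where q: "q \<in> K" "r i' ** s j' ** q = mat 1"
      using matrix_group_inverse[OF K rs(2)] by metis
    have "r i ** s j ** q = a ** (r i' ** s j' ** q)" using a(2) by (simp add: matrix_mul_assoc)
    then have "a = r i ** s j ** q" by (simp add: q(2))
    then have "a \<in> K" using q(1) rs(1)[of i j] matrix_group_mult[OF K] by metis
    then have aB: "a \<in> B" using a(1) assms(8) by auto
    obtain h where h: "h \<in> H" "h ** r i = mat 1" using matrix_group_inverse[OF H r(2)] by metis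
    have "h ** (r i ** s j) = h ** a ** r i' ** s j'" by (simp add: a(2) matrix_mul_assoc)
    then have sj: "s j = h ** a ** r i' ** s j'" by (simp add: h(2) matrix_mul_assoc)
    have "h ** a ** r i' \<in> H" using h aB r(2) assms(6) by (auto intro!: matrix_group_mult[OF H])
    then have "coset H (s j) = coset H (s j')" using sj by (auto simp: coset_eq_iff[OF H])
    then have j: "j = j'" using s(1) ij by (auto simp: bij_betw_def inj_on_def)
    obtain t where "s j ** t = mat 1" using matrix_group_inverse[OF K s(2)] by metis
    then have "r i = a ** r i'"
      using a(2) j matrix_mult_right_cancel[of "s j" t "r i" "a ** r i'"] by (simp add: matrix_mul_assoc)
    then have "coset B (r i) = coset B (r i')" using aB by (auto simp: coset_eq_iff[OF B])
    then have "i = i'" using r(1) ij by (auto simp: bij_betw_def inj_on_def)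
    then show "j = j' \<and> i = i'" using j by simp
  qed
  have "coset A k \<in> (\<lambda>(j, i). coset A (r i ** s j)) ` (J \<times> I)" if k: "k \<in> K" for k
  proof -
    have "coset H k \<in> (\<lambda>j. coset H (s j)) ` J" using s(1) k by (auto simp: bij_betw_def)
    then obtain j h where j: "j \<in> J" "h \<in> H" "k = h ** s j" by (auto simp: coset_eq_iff[OF H])
    have "coset B h \<in> (\<lambda>i. coset B (r i)) ` I" using r(1) j(2) by (auto simp: bij_betw_def)
    then obtain i b where i: "i \<in> I" "b \<in> B" "h = b ** r i" by (auto simp: coset_eq_iff[OF B])
    have "k = b ** (r i ** s j)" using i j by (simp add: matrix_mul_assoc)
    then have "coset A k = coset A (r i ** s j)"
      using i(2) assms(5) by (auto simp: coset_eq_iff[OF A])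
    then show ?thesis using i(1) j(1) by force
  qed
  moreover have "r i ** s j \<in> K" for i j
    using r(2) s(2) assms(7) by (auto intro!: matrix_group_mult[OF K])
  ultimately show "(\<lambda>(j, i). coset A (r i ** s j)) ` (J \<times> I) = coset A ` K" by auto
qed

lemma coset_mono_eq:
  assumes "matrix_group A" "matrix_group B" "B \<subseteq> A" "coset B x = coset B y"
  shows "coset A x = coset A y"
  using assms(3,4) by (auto simp: coset_eq_iff[OF assms(1)] coset_eq_iff[OF assms(2)])

lemma finite_coset_mono:
  assumes A: "matrix_group A" and B: "matrix_group B" and "B \<subseteq> A" and fin: "finite (coset B ` K)"
  shows "finite (coset A ` K)"
proof -
  have "coset A k = coset A (coset_rep (coset B k))" for k
    by (intro coset_mono_eq[OF A B assms(3)] coset_coset_rep[OF B, symmetric])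
  then have "coset A ` K = (\<lambda>c. coset A (coset_rep c)) ` coset B ` K"
    unfolding image_image by (rule image_cong[OF refl])
  then show ?thesis using fin by simp
qed


section \<open>The action on the Siegel upper half space\<close>

lemma vector_4 [simp]:
  "(vector [x, y, z, w] :: 'a::zero^4) $ 1 = x"
  "(vector [x, y, z, w] :: 'a::zero^4) $ 2 = y"
  "(vector [x, y, z, w] :: 'a::zero^4) $ 3 = z"
  "(vector [x, y, z, w] :: 'a::zero^4) $ 4 = w"
  by (simp_all add: vector_def)

lemmas mat4_simps = vec_eq_iff forall_4 matrix_matrix_mult_def sum_4 mat_rows_def transpose_def

text \<open>A common ambient group: it contains the arithmetic groups as well as
  \<open>F_mat\<close> and \<open>mu_mat\<close>, and the multiplier is 1 on it, so the first factor
  drops out of \<open>slash\<close>.\<close>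

definition SpR :: "mat4 set" where
  "SpR = {\<gamma>. transpose \<gamma> ** Jmat ** \<gamma> = Jmat}"

lemma Jmat_nth:
  "Jmat $ 1 $ 1 = 0" "Jmat $ 1 $ 2 = 0" "Jmat $ 1 $ 3 = 1" "Jmat $ 1 $ 4 = 0"
  "Jmat $ 2 $ 1 = 0" "Jmat $ 2 $ 2 = 0" "Jmat $ 2 $ 3 = 0" "Jmat $ 2 $ 4 = 1"
  "Jmat $ 3 $ 1 = -1" "Jmat $ 3 $ 2 = 0" "Jmat $ 3 $ 3 = 0" "Jmat $ 3 $ 4 = 0"
  "Jmat $ 4 $ 1 = 0" "Jmat $ 4 $ 2 = -1" "Jmat $ 4 $ 3 = 0" "Jmat $ 4 $ 4 = 0"
  by (simp_all add: Jmat_def mat_rows_def)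

lemma SpR_mult: "g \<in> SpR \<Longrightarrow> h \<in> SpR \<Longrightarrow> g ** h \<in> SpR"
  unfolding SpR_def
  by (simp add: matrix_transpose_mul) (metis matrix_mul_assoc)

text \<open>The matrix \<open>transpose g ** Jmat ** g\<close> is antisymmetric, so its six entries
  above the diagonal decide. Membership becomes a list of polynomial identities fit for
  \<open>simp\<close> and \<open>algebra\<close>.\<close>

lemma SpR_iff:
  "g \<in> SpR \<longleftrightarrow>
    g$1$1 * g$3$2 + g$2$1 * g$4$2 - g$3$1 * g$1$2 - g$4$1 * g$2$2 = 0 \<and>
    g$1$3 * g$3$4 + g$2$3 * g$4$4 - g$3$3 * g$1$4 - g$4$3 * g$2$4 = 0 \<and>
    g$1$1 * g$3$3 + g$2$1 * g$4$3 - g$3$1 * g$1$3 - g$4$1 * g$2$3 = 1 \<and>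
    g$1$1 * g$3$4 + g$2$1 * g$4$4 - g$3$1 * g$1$4 - g$4$1 * g$2$4 = 0 \<and>
    g$1$2 * g$3$3 + g$2$2 * g$4$3 - g$3$2 * g$1$3 - g$4$2 * g$2$3 = 0 \<and>
    g$1$2 * g$3$4 + g$2$2 * g$4$4 - g$3$2 * g$1$4 - g$4$2 * g$2$4 = 1"
  unfolding SpR_def
  by (simp add: vec_eq_iff forall_4 matrix_matrix_mult_def sum_4 transpose_def Jmat_nth) argo

lemma multiplier_SpR: "g \<in> SpR \<Longrightarrow> multiplier g = 1"
proof -
  have "m = 1" if "Jmat = m *\<^sub>R Jmat" for m
    using arg_cong[OF that, of "\<lambda>J. J $ 1 $ 3"] by (simp add: Jmat_nth)
  then show "g \<in> SpR \<Longrightarrow> multiplier g = 1"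
    unfolding SpR_def multiplier_def by (auto intro!: the_equality)
qed

definition numer :: "mat4 \<Rightarrow> complex^2^2 \<Rightarrow> complex^2^2" where
  "numer g \<Omega> = blockA g ** \<Omega> + blockB g"

definition denom :: "mat4 \<Rightarrow> complex^2^2 \<Rightarrow> complex^2^2" where
  "denom g \<Omega> = blockC g ** \<Omega> + blockD g"

definition moebius :: "mat4 \<Rightarrow> complex^2^2 \<Rightarrow> complex^2^2" where
  "moebius g \<Omega> = numer g \<Omega> ** matrix_inv (denom g \<Omega>)"

lemma slash_SpR:
  "g \<in> SpR \<Longrightarrow> slash k f g \<Omega> = det (denom g \<Omega>) powi (- k) * f (moebius g \<Omega>)"
  by (simp add: slash_def multiplier_SpR denom_def numer_def moebius_def)

lemmas mat2_simps = vec_eq_iff forall_2 matrix_matrix_mult_def sum_2 matrix_vector_mult_def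

lemma numer_nth:
  "numer g \<Omega> $ 1 $ 1 = g$1$1 * \<Omega>$1$1 + g$1$2 * \<Omega>$2$1 + g$1$3"
  "numer g \<Omega> $ 1 $ 2 = g$1$1 * \<Omega>$1$2 + g$1$2 * \<Omega>$2$2 + g$1$4"
  "numer g \<Omega> $ 2 $ 1 = g$2$1 * \<Omega>$1$1 + g$2$2 * \<Omega>$2$1 + g$2$3"
  "numer g \<Omega> $ 2 $ 2 = g$2$1 * \<Omega>$1$2 + g$2$2 * \<Omega>$2$2 + g$2$4"
  by (simp_all add: numer_def blockA_def blockB_def matrix_matrix_mult_def sum_2
      upper_ix_def lower_ix_def)

lemma denom_nth:
  "denom g \<Omega> $ 1 $ 1 = g$3$1 * \<Omega>$1$1 + g$3$2 * \<Omega>$2$1 + g$3$3"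
  "denom g \<Omega> $ 1 $ 2 = g$3$1 * \<Omega>$1$2 + g$3$2 * \<Omega>$2$2 + g$3$4"
  "denom g \<Omega> $ 2 $ 1 = g$4$1 * \<Omega>$1$1 + g$4$2 * \<Omega>$2$1 + g$4$3"
  "denom g \<Omega> $ 2 $ 2 = g$4$1 * \<Omega>$1$2 + g$4$2 * \<Omega>$2$2 + g$4$4"
  by (simp_all add: denom_def blockC_def blockD_def matrix_matrix_mult_def sum_2
      upper_ix_def lower_ix_def)

lemma H2_sym: "\<Omega> \<in> H2 \<Longrightarrow> \<Omega>$2$1 = \<Omega>$1$2"
  by (auto simp: H2_def transpose_def vec_eq_iff)

text \<open>With \<open>z = (u, w) \<in> \<complex>\<^sup>4\<close> this is the symplectic pairing of \<open>Im z\<close> and \<open>Re z\<close>, up to sign, hence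
  invariant under real symplectic matrices.\<close>

definition herm :: "complex^2 \<Rightarrow> complex^2 \<Rightarrow> real" where
  "herm w u = Im (cnj (w$1) * u$1 + cnj (w$2) * u$2)"

text \<open>Write \<open>v = x + i y\<close>. By symmetry the real part of \<Omega> contributes
  nothing and the cross terms cancel, which leaves the values of the imaginary part at
  \<open>x\<close> and at \<open>y\<close>.\<close>

lemma herm_H2_pos:
  assumes "\<Omega> \<in> H2" "v \<noteq> 0"
  shows "herm v (\<Omega> *v v) > 0"
proof -
  define x y :: "real^2" where "x = (\<chi> i. Re (v$i))" and "y = (\<chi> i. Im (v$i))"
  have "herm v (\<Omega> *v v) = x \<bullet> (Im_mat \<Omega> *v x) + y \<bullet> (Im_mat \<Omega> *v y)"
    by (simp add: herm_def x_def y_def inner_vec_def sum_2 matrix_vector_mult_def Im_mat_def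
        H2_sym[OF assms(1)] algebra_simps)
  moreover have "x \<noteq> 0 \<or> y \<noteq> 0"
    using assms(2) by (auto simp: x_def y_def vec_eq_iff complex_eq_iff)
  moreover have pos: "z \<bullet> (Im_mat \<Omega> *v z) > 0" if "z \<noteq> 0" for z
    using assms(1) that by (auto simp: H2_def)
  then have "z \<bullet> (Im_mat \<Omega> *v z) \<ge> 0" for z
    by (cases "z = 0") (auto intro: less_imp_le)
  ultimately show ?thesis using pos by (metis add_nonneg_pos add_pos_nonneg)
qed

text \<open>The vectors \<open>numer g \<Omega> *v v\<close> and
  \<open>denom g \<Omega> *v v\<close> are the two halves of \<open>g\<close> applied to the vector
  with halves \<open>\<Omega> *v v\<close> and \<open>v\<close>, so this is the invariance of the
  symplectic form.\<close>

lemma herm_SpR: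
  assumes g: "g \<in> SpR"
  shows "herm (denom g \<Omega> *v v) (numer g \<Omega> *v v) = herm v (\<Omega> *v v)"
proof -
  define s where "s = \<Omega> *v v"
  have n: "(numer g \<Omega> *v v) $ 1 = g$1$1 * s$1 + g$1$2 * s$2 + g$1$3 * v$1 + g$1$4 * v$2"
    "(numer g \<Omega> *v v) $ 2 = g$2$1 * s$1 + g$2$2 * s$2 + g$2$3 * v$1 + g$2$4 * v$2"
    "(denom g \<Omega> *v v) $ 1 = g$3$1 * s$1 + g$3$2 * s$2 + g$3$3 * v$1 + g$3$4 * v$2"
    "(denom g \<Omega> *v v) $ 2 = g$4$1 * s$1 + g$4$2 * s$2 + g$4$3 * v$1 + g$4$4 * v$2"
    by (simp_all add: s_def matrix_vector_mult_def sum_2 numer_nth denom_nth algebra_simps)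
  show ?thesis
    using g[unfolded SpR_iff] unfolding s_def[symmetric]
    by (simp add: herm_def n) algebra
qed

text \<open>A kernel vector of the denominator would make the invariant form vanish, against its
  positivity.\<close>

lemma det_denom_nonzero:
  assumes g: "g \<in> SpR" and \<Omega>: "\<Omega> \<in> H2"
  shows "det (denom g \<Omega>) \<noteq> 0"
proof
  assume "det (denom g \<Omega>) = 0"
  then have "\<not> invertible (denom g \<Omega>)" by (simp add: invertible_det_nz)
  then obtain v where v: "v \<noteq> 0" "denom g \<Omega> *v v = 0"
    by (metis invertible_left_inverse matrix_left_invertible_ker)
  have "herm (denom g \<Omega> *v v) (numer g \<Omega> *v v) = 0" by (simp add: v herm_def)
  then show False using herm_H2_pos[OF \<Omega> v(1)] herm_SpR[OF g, of \<Omega> v] by simp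
qed

lemma matrix_inv_unique:
  fixes A B :: "'a::field^'n^'n"
  assumes "A ** B = mat 1"
  shows "matrix_inv A = B"
proof -
  have BA: "B ** A = mat 1" using assms by (simp add: matrix_left_right_inverse)
  have "\<exists>X. A ** X = mat 1 \<and> X ** A = mat 1" using assms BA by blast
  then have "A ** matrix_inv A = mat 1 \<and> matrix_inv A ** A = mat 1"
    unfolding matrix_inv_def by (rule someI_ex)
  then show ?thesis using BA by (metis matrix_mul_assoc matrix_mul_lid matrix_mul_rid)
qed

lemma matrix_inv_nonsingular:
  fixes A :: "'a::field^'n^'n"
  assumes "det A \<noteq> 0"
  shows "A ** matrix_inv A = mat 1" "matrix_inv A ** A = mat 1"
proof -
  obtain X where X: "A ** X = mat 1" "X ** A = mat 1"
    using assms invertible_det_nz[of A] by (auto simp: invertible_def)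
  then show "A ** matrix_inv A = mat 1" "matrix_inv A ** A = mat 1"
    using matrix_inv_unique[OF X(1)] by simp_all
qed

lemma matrix_inv_2:
  fixes A :: "'a::field^2^2"
  assumes "det A \<noteq> 0"
  shows "matrix_inv A $ 1 $ 1 = A$2$2 / det A" "matrix_inv A $ 1 $ 2 = - A$1$2 / det A"
    "matrix_inv A $ 2 $ 1 = - A$2$1 / det A" "matrix_inv A $ 2 $ 2 = A$1$1 / det A"
proof -
  define B :: "'a^2^2" where
    "B = vector [vector [A$2$2 / det A, - A$1$2 / det A], vector [- A$2$1 / det A, A$1$1 / det A]]"
  have "A ** B = mat 1"
    using assms by (simp add: B_def mat2_simps mat_def divide_simps) (simp add: det_2 algebra_simps)
  then have "matrix_inv A = B" by (rule matrix_inv_unique)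
  then show "matrix_inv A $ 1 $ 1 = A$2$2 / det A" "matrix_inv A $ 1 $ 2 = - A$1$2 / det A"
    "matrix_inv A $ 2 $ 1 = - A$2$1 / det A" "matrix_inv A $ 2 $ 2 = A$1$1 / det A"
    by (simp_all add: B_def)
qed

text \<open>Symmetry of the quotient amounts to
  \<open>transpose ?X ** ?Y = transpose ?Y ** ?X\<close>, which follows from the symplectic
  relations. Positivity comes from \<open>herm_SpR\<close>, applied to the preimage of a real vector
  under \<open>?Y\<close>.\<close>

lemma moebius_H2:
  assumes g: "g \<in> SpR" and \<Omega>: "\<Omega> \<in> H2"
  shows "moebius g \<Omega> \<in> H2"
proof -
  let ?X = "numer g \<Omega>" and ?Y = "denom g \<Omega>"
  have nz: "det ?Y \<noteq> 0" by (rule det_denom_nonzero[OF assms])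
  \<comment> \<open>This is entry (1,2) of \<open>transpose ?X ** ?Y = transpose ?Y ** ?X\<close>;
    the diagonal entries agree trivially.\<close>
  have "?X$1$1 * ?Y$1$2 + ?X$2$1 * ?Y$2$2 = ?X$1$2 * ?Y$1$1 + ?X$2$2 * ?Y$2$1"
  proof -
    \<comment> \<open>The relations of \<open>SpR_iff\<close> are carried over to the complex
      numbers, so that \<open>algebra\<close> can combine them with the entries of \<Omega>.\<close>
    have r: "of_real (g$1$1) * of_real (g$3$2) + of_real (g$2$1) * of_real (g$4$2)
        - of_real (g$3$1) * of_real (g$1$2) - of_real (g$4$1) * of_real (g$2$2) = (0::complex)"
      "of_real (g$1$3) * of_real (g$3$4) + of_real (g$2$3) * of_real (g$4$4)
        - of_real (g$3$3) * of_real (g$1$4) - of_real (g$4$3) * of_real (g$2$4) = (0::complex)"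
      "of_real (g$1$1) * of_real (g$3$3) + of_real (g$2$1) * of_real (g$4$3)
        - of_real (g$3$1) * of_real (g$1$3) - of_real (g$4$1) * of_real (g$2$3) = (1::complex)"
      "of_real (g$1$1) * of_real (g$3$4) + of_real (g$2$1) * of_real (g$4$4)
        - of_real (g$3$1) * of_real (g$1$4) - of_real (g$4$1) * of_real (g$2$4) = (0::complex)"
      "of_real (g$1$2) * of_real (g$3$3) + of_real (g$2$2) * of_real (g$4$3)
        - of_real (g$3$2) * of_real (g$1$3) - of_real (g$4$2) * of_real (g$2$3) = (0::complex)"
      "of_real (g$1$2) * of_real (g$3$4) + of_real (g$2$2) * of_real (g$4$4)
        - of_real (g$3$2) * of_real (g$1$4) - of_real (g$4$2) * of_real (g$2$4) = (1::complex)"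
      using g[unfolded SpR_iff]
      unfolding of_real_mult[symmetric] of_real_add[symmetric] of_real_diff[symmetric] by simp_all
    show ?thesis
      unfolding numer_nth denom_nth H2_sym[OF \<Omega>] using r by algebra
  qed
  then have "moebius g \<Omega> $ 1 $ 2 = moebius g \<Omega> $ 2 $ 1"
    using nz
    by (simp add: moebius_def matrix_matrix_mult_def sum_2 matrix_inv_2 divide_simps) algebra
  then have "transpose (moebius g \<Omega>) = moebius g \<Omega>"
    by (simp add: transpose_def vec_eq_iff forall_2)
  moreover have "x \<bullet> (Im_mat (moebius g \<Omega>) *v x) > 0" if "x \<noteq> 0" for x
  proof -
    \<comment> \<open>On a vector with real entries, \<open>herm\<close> reduces to the quadratic
      form of the imaginary part.\<close>
    define w :: "complex^2" where "w = (\<chi> i. of_real (x$i))"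
    define v where "v = matrix_inv ?Y *v w"
    have Yv: "?Y *v v = w"
      by (simp add: v_def matrix_vector_mul_assoc matrix_inv_nonsingular(1)[OF nz])
    have "w \<noteq> 0" using that by (auto simp: w_def vec_eq_iff)
    then have "v \<noteq> 0" using Yv by auto
    have "x \<bullet> (Im_mat (moebius g \<Omega>) *v x) = herm w (moebius g \<Omega> *v w)"
      by (simp add: herm_def w_def inner_vec_def sum_2 matrix_vector_mult_def Im_mat_def)
    also have "moebius g \<Omega> *v w = ?X *v v"
      by (simp add: moebius_def v_def matrix_vector_mul_assoc)
    also have "herm w (?X *v v) = herm v (\<Omega> *v v)" using herm_SpR[OF g, of \<Omega> v] Yv by simp
    finally show ?thesis using herm_H2_pos[OF \<Omega> \<open>v \<noteq> 0\<close>] by simp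
  qed
  ultimately show ?thesis by (simp add: H2_def)
qed

section \<open>The cocycle relation and the slash action\<close>

lemma matrix_add_rdistrib:
  fixes A B :: "'a::semiring_1^'n^'m" and C :: "'a^'k^'n"
  shows "(A + B) ** C = A ** C + B ** C"
  by (simp add: matrix_matrix_mult_def vec_eq_iff distrib_right sum.distrib)

text \<open>Stacked, \<open>numer\<close> and \<open>denom\<close> are the matrix times the column
  of blocks \<Omega>, 1. The factor \<open>h\<close> turns this column into that of
  \<open>moebius h \<Omega>\<close>, 1, multiplied on the right by
  \<open>denom h \<Omega>\<close>.\<close>

lemma numer_denom_mult:
  assumes h: "h \<in> SpR" and \<Omega>: "\<Omega> \<in> H2"
  shows "numer (g ** h) \<Omega> = numer g (moebius h \<Omega>) ** denom h \<Omega>"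
    and "denom (g ** h) \<Omega> = denom g (moebius h \<Omega>) ** denom h \<Omega>"
proof -
  have "moebius h \<Omega> ** denom h \<Omega> = numer h \<Omega>"
    using matrix_inv_nonsingular(2)[OF det_denom_nonzero[OF assms]]
    by (simp add: moebius_def matrix_mul_assoc[symmetric])
  then have m: "M ** moebius h \<Omega> ** denom h \<Omega> = M ** numer h \<Omega>" for M
    by (simp add: matrix_mul_assoc[symmetric])
  have "numer (g ** h) \<Omega> = blockA g ** numer h \<Omega> + blockB g ** denom h \<Omega>"
    "denom (g ** h) \<Omega> = blockC g ** numer h \<Omega> + blockD g ** denom h \<Omega>"
    by (simp_all add: vec_eq_iff forall_2 numer_nth denom_nth matrix_matrix_mult_def sum_2 sum_4
        blockA_def blockB_def blockC_def blockD_def upper_ix_def lower_ix_def algebra_simps)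
  then show "numer (g ** h) \<Omega> = numer g (moebius h \<Omega>) ** denom h \<Omega>"
    "denom (g ** h) \<Omega> = denom g (moebius h \<Omega>) ** denom h \<Omega>"
    by (simp_all add: numer_def[of g] denom_def[of g] matrix_add_rdistrib m)
qed

lemma moebius_mult:
  assumes g: "g \<in> SpR" and h: "h \<in> SpR" and \<Omega>: "\<Omega> \<in> H2"
  shows "moebius (g ** h) \<Omega> = moebius g (moebius h \<Omega>)"
proof -
  let ?Y = "denom g (moebius h \<Omega>)" and ?Z = "denom h \<Omega>"
  have nz: "det ?Y \<noteq> 0" "det ?Z \<noteq> 0"
    using det_denom_nonzero moebius_H2 assms by auto
  have "(?Y ** ?Z) ** (matrix_inv ?Z ** matrix_inv ?Y) = ?Y ** (?Z ** matrix_inv ?Z) ** matrix_inv ?Y"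
    by (simp add: matrix_mul_assoc)
  then have "matrix_inv (?Y ** ?Z) = matrix_inv ?Z ** matrix_inv ?Y"
    by (intro matrix_inv_unique) (simp add: matrix_inv_nonsingular nz)
  then have "moebius (g ** h) \<Omega> = numer g (moebius h \<Omega>) ** (?Z ** matrix_inv ?Z) ** matrix_inv ?Y"
    unfolding moebius_def[of "g ** h"] by (simp add: numer_denom_mult[OF h \<Omega>] matrix_mul_assoc)
  then show ?thesis by (simp add: matrix_inv_nonsingular nz moebius_def[of g])
qed

lemma slash_mult:
  assumes "g \<in> SpR" "h \<in> SpR" "\<Omega> \<in> H2"
  shows "slash k (slash k f g) h \<Omega> = slash k f (g ** h) \<Omega>"
  using assms
  by (simp add: slash_SpR SpR_mult numer_denom_mult det_mul moebius_mult power_int_mult_distrib)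

text \<open>Forms are controlled on \<open>H2\<close> only. As \<open>moebius\<close> preserves
  \<open>H2\<close>, identities known just there may be used under \<open>slash\<close>.\<close>

lemma slash_cong:
  assumes "g \<in> SpR" "\<Omega> \<in> H2" "\<And>\<Omega>. \<Omega> \<in> H2 \<Longrightarrow> f \<Omega> = f' \<Omega>"
  shows "slash k f g \<Omega> = slash k f' g \<Omega>"
  using assms by (simp add: slash_SpR moebius_H2)

lemma slash_sum:
  assumes "g \<in> SpR"
  shows "slash k (\<lambda>\<Omega>. \<Sum>i\<in>I. f i \<Omega>) g \<Omega> = (\<Sum>i\<in>I. slash k (f i) g \<Omega>)"
  using assms by (simp add: slash_SpR sum_distrib_left)

section \<open>Holomorphic functions on the half space\<close>

lemma mat_mult_nth: "(mat c ** Z) $ i $ j = c * Z $ i $ j"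
  by (simp add: matrix_matrix_mult_def mat_def if_distrib[of "\<lambda>x. x * _"] cong: if_cong)

lemma holomorphic_on_H2_const: "holomorphic_on_H2 (\<lambda>_. a)"
  unfolding holomorphic_on_H2_def by (auto intro!: exI[of _ "\<lambda>_. 0"])

lemma holomorphic_on_H2_nth: "holomorphic_on_H2 (\<lambda>\<Omega>. \<Omega> $ i $ j)"
  unfolding holomorphic_on_H2_def
proof (intro ballI exI conjI allI)
  show "((\<lambda>\<Omega>. \<Omega> $ i $ j) has_derivative (\<lambda>Z. Z $ i $ j)) (at \<Omega> within H2)" for \<Omega> :: "complex^2^2"
    by (intro bounded_linear_imp_has_derivative
        bounded_linear_compose[OF bounded_linear_vec_nth bounded_linear_vec_nth])
qed (rule mat_mult_nth)

lemma holomorphic_on_H2_add: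
  assumes "holomorphic_on_H2 f" "holomorphic_on_H2 g"
  shows "holomorphic_on_H2 (\<lambda>\<Omega>. f \<Omega> + g \<Omega>)"
  unfolding holomorphic_on_H2_def
proof
  fix \<Omega> assume "\<Omega> \<in> H2"
  then obtain L M where "(f has_derivative L) (at \<Omega> within H2)" "\<And>c Z. L (mat c ** Z) = c * L Z"
    "(g has_derivative M) (at \<Omega> within H2)" "\<And>c Z. M (mat c ** Z) = c * M Z"
    using assms unfolding holomorphic_on_H2_def by blast
  then show "\<exists>L. ((\<lambda>\<Omega>. f \<Omega> + g \<Omega>) has_derivative L) (at \<Omega> within H2) \<and>
      (\<forall>c Z. L (mat c ** Z) = c * L Z)"
    by (intro exI[of _ "\<lambda>Z. L Z + M Z"]) (auto intro!: derivative_intros simp: algebra_simps)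
qed

lemma holomorphic_on_H2_mult:
  assumes "holomorphic_on_H2 f" "holomorphic_on_H2 g"
  shows "holomorphic_on_H2 (\<lambda>\<Omega>. f \<Omega> * g \<Omega>)"
  unfolding holomorphic_on_H2_def
proof
  fix \<Omega> assume "\<Omega> \<in> H2"
  then obtain L M where "(f has_derivative L) (at \<Omega> within H2)" "\<And>c Z. L (mat c ** Z) = c * L Z"
    "(g has_derivative M) (at \<Omega> within H2)" "\<And>c Z. M (mat c ** Z) = c * M Z"
    using assms unfolding holomorphic_on_H2_def by blast
  then show "\<exists>L. ((\<lambda>\<Omega>. f \<Omega> * g \<Omega>) has_derivative L) (at \<Omega> within H2) \<and>
      (\<forall>c Z. L (mat c ** Z) = c * L Z)"
    by (intro exI[of _ "\<lambda>Z. f \<Omega> * M Z + L Z * g \<Omega>"] conjI has_derivative_mult)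
      (auto simp: algebra_simps)
qed

lemma holomorphic_on_H2_power_int:
  assumes "holomorphic_on_H2 f" "\<And>\<Omega>. \<Omega> \<in> H2 \<Longrightarrow> f \<Omega> \<noteq> 0"
  shows "holomorphic_on_H2 (\<lambda>\<Omega>. f \<Omega> powi n)"
  unfolding holomorphic_on_H2_def
proof
  fix \<Omega> assume \<Omega>: "\<Omega> \<in> H2"
  then obtain L where L: "(f has_derivative L) (at \<Omega> within H2)" "\<And>c Z. L (mat c ** Z) = c * L Z"
    using assms unfolding holomorphic_on_H2_def by blast
  show "\<exists>L. ((\<lambda>\<Omega>. f \<Omega> powi n) has_derivative L) (at \<Omega> within H2) \<and>
      (\<forall>c Z. L (mat c ** Z) = c * L Z)"
    using has_derivative_power_int[OF assms(2)[OF \<Omega>] L(1), of n]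
    by (intro exI conjI) (auto simp: L(2))
qed

lemma holomorphic_on_H2_sum:
  "(\<And>i. i \<in> I \<Longrightarrow> holomorphic_on_H2 (f i)) \<Longrightarrow> holomorphic_on_H2 (\<lambda>\<Omega>. \<Sum>i\<in>I. f i \<Omega>)"
  by (induction I rule: infinite_finite_induct)
    (auto intro!: holomorphic_on_H2_add holomorphic_on_H2_const)

text \<open>A basis vector is supported in one coordinate, so the inner product with it sees a
  single component. Applied twice, this reduces matrix-valued maps to their entries.\<close>

lemma has_derivative_vec_nth:
  fixes f :: "'a::real_normed_vector \<Rightarrow> 'b::euclidean_space^'n"
  assumes "\<And>i. ((\<lambda>x. f x $ i) has_derivative (\<lambda>h. f' h $ i)) (at x within S)"
  shows "(f has_derivative f') (at x within S)"
  unfolding has_derivative_componentwise_within[of f]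
proof
  fix b :: "'b^'n" assume "b \<in> Basis"
  then obtain i u where b: "b = axis i u" by (auto simp: Basis_vec_def)
  have "((\<lambda>x. f x $ i \<bullet> u) has_derivative (\<lambda>h. f' h $ i \<bullet> u)) (at x within S)"
    using assms by (rule has_derivative_inner_left)
  then show "((\<lambda>x. f x \<bullet> b) has_derivative (\<lambda>h. f' h \<bullet> b)) (at x within S)"
    by (simp add: b inner_axis)
qed

text \<open>The chain rule is taken within \<open>H2\<close>, hence the inner map must preserve
  \<open>H2\<close>. Complex linearity survives because the inner derivative commutes with
  multiplication by \<open>mat c\<close>.\<close>

lemma holomorphic_on_H2_compose:
  assumes f: "holomorphic_on_H2 f" and "\<phi> ` H2 \<subseteq> H2"
    and \<phi>: "\<And>i j. holomorphic_on_H2 (\<lambda>\<Omega>. \<phi> \<Omega> $ i $ j)"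
  shows "holomorphic_on_H2 (\<lambda>\<Omega>. f (\<phi> \<Omega>))"
  unfolding holomorphic_on_H2_def
proof
  fix \<Omega> assume \<Omega>: "\<Omega> \<in> H2"
  have "\<forall>i j. \<exists>L. ((\<lambda>\<Omega>. \<phi> \<Omega> $ i $ j) has_derivative L) (at \<Omega> within H2) \<and>
      (\<forall>c Z. L (mat c ** Z) = c * L Z)"
    using \<phi> \<Omega> by (auto simp: holomorphic_on_H2_def)
  then obtain L where L: "\<And>i j. ((\<lambda>\<Omega>. \<phi> \<Omega> $ i $ j) has_derivative L i j) (at \<Omega> within H2)"
    "\<And>i j c Z. L i j (mat c ** Z) = c * L i j Z"
    by metis
  define \<phi>' :: "complex^2^2 \<Rightarrow> complex^2^2" where "\<phi>' Z = (\<chi> i j. L i j Z)" for Z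
  have \<phi>'1: "(\<phi> has_derivative \<phi>') (at \<Omega> within H2)"
    by (intro has_derivative_vec_nth) (simp add: \<phi>'_def L(1))
  have \<phi>'2: "\<phi>' (mat c ** Z) = mat c ** \<phi>' Z" for c Z
    by (simp add: vec_eq_iff mat_mult_nth \<phi>'_def L(2))
  obtain M where M: "(f has_derivative M) (at (\<phi> \<Omega>) within H2)" "\<And>c Z. M (mat c ** Z) = c * M Z"
    using f[unfolded holomorphic_on_H2_def] imageI[OF \<Omega>, of \<phi>] assms(2) by blast
  have "((\<lambda>\<Omega>. f (\<phi> \<Omega>)) has_derivative (\<lambda>Z. M (\<phi>' Z))) (at \<Omega> within H2)"
    using has_derivative_in_compose[OF \<phi>'1 has_derivative_subset[OF M(1) assms(2)]] .
  then show "\<exists>L. ((\<lambda>\<Omega>. f (\<phi> \<Omega>)) has_derivative L) (at \<Omega> within H2) \<and>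
      (\<forall>c Z. L (mat c ** Z) = c * L Z)"
    by (auto simp: \<phi>'2 M(2))
qed

lemma holomorphic_on_H2_cong:
  assumes "holomorphic_on_H2 f" "\<And>\<Omega>. \<Omega> \<in> H2 \<Longrightarrow> f \<Omega> = g \<Omega>"
  shows "holomorphic_on_H2 g"
  using assms unfolding holomorphic_on_H2_def by (metis has_derivative_transform)

text \<open>The entries of \<open>moebius\<close> are rational functions whose only denominator is
  \<open>det (denom g \<Omega>)\<close>, which has no zero on \<open>H2\<close>; the closure
  properties then suffice.\<close>

lemma holomorphic_on_H2_slash:
  assumes f: "holomorphic_on_H2 f" and g: "g \<in> SpR"
  shows "holomorphic_on_H2 (slash k f g)"
proof -
  note hol = holomorphic_on_H2_add holomorphic_on_H2_mult holomorphic_on_H2_const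
    holomorphic_on_H2_nth
  have n: "holomorphic_on_H2 (\<lambda>\<Omega>. numer g \<Omega> $ i $ j)" for i j
    using exhaust_2[of i] exhaust_2[of j] by (auto simp: numer_nth intro!: hol)
  have d: "holomorphic_on_H2 (\<lambda>\<Omega>. denom g \<Omega> $ i $ j)" for i j
    using exhaust_2[of i] exhaust_2[of j] by (auto simp: denom_nth intro!: hol)
  have "holomorphic_on_H2 (\<lambda>\<Omega>. denom g \<Omega> $ 1 $ 1 * denom g \<Omega> $ 2 $ 2
      + (- 1) * (denom g \<Omega> $ 1 $ 2 * denom g \<Omega> $ 2 $ 1))"
    by (intro hol d)
  then have dd: "holomorphic_on_H2 (\<lambda>\<Omega>. det (denom g \<Omega>))" by (simp add: det_2)
  have pow: "holomorphic_on_H2 (\<lambda>\<Omega>. det (denom g \<Omega>) powi n)" for n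
    by (intro holomorphic_on_H2_power_int dd det_denom_nonzero[OF g])
  let ?I = "\<lambda>\<Omega>. matrix_inv (denom g \<Omega>)"
  \<comment> \<open>One template for the four entries of the inverse: \<open>a\<close> carries the
    cofactor sign, and the power -1 the division by the determinant.\<close>
  have *: "holomorphic_on_H2 (\<lambda>\<Omega>. a * (denom g \<Omega> $ i $ j * det (denom g \<Omega>) powi (-1)))" for a i j
    by (intro hol d pow)
  have inv: "holomorphic_on_H2 (\<lambda>\<Omega>. ?I \<Omega> $ i $ j)" for i j
  proof -
    have "holomorphic_on_H2 (\<lambda>\<Omega>. ?I \<Omega> $ 1 $ 1)" "holomorphic_on_H2 (\<lambda>\<Omega>. ?I \<Omega> $ 2 $ 2)"
      "holomorphic_on_H2 (\<lambda>\<Omega>. ?I \<Omega> $ 1 $ 2)" "holomorphic_on_H2 (\<lambda>\<Omega>. ?I \<Omega> $ 2 $ 1)"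
      by (rule holomorphic_on_H2_cong[OF *[of 1 2 2]] holomorphic_on_H2_cong[OF *[of 1 1 1]]
          holomorphic_on_H2_cong[OF *[of "-1" 1 2]] holomorphic_on_H2_cong[OF *[of "-1" 2 1]],
          simp add: matrix_inv_2 det_denom_nonzero[OF g] power_int_minus field_simps)+
    then show ?thesis using exhaust_2[of i] exhaust_2[of j] by auto
  qed
  have "holomorphic_on_H2 (\<lambda>\<Omega>. moebius g \<Omega> $ i $ j)" for i j
    unfolding moebius_def matrix_matrix_mult_def
    by (simp add: sum_2) (intro hol n inv)
  then have "holomorphic_on_H2 (\<lambda>\<Omega>. f (moebius g \<Omega>))"
    by (intro holomorphic_on_H2_compose[OF f]) (auto simp: moebius_H2[OF g])
  then have "holomorphic_on_H2 (\<lambda>\<Omega>. det (denom g \<Omega>) powi (- k) * f (moebius g \<Omega>))"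
    by (intro hol pow)
  then show ?thesis by (rule holomorphic_on_H2_cong) (simp add: slash_SpR[OF g])
qed

section \<open>Slash invariance and the action of Hecke operators\<close>

definition slash_invariant :: "int \<Rightarrow> mat4 set \<Rightarrow> (complex^2^2 \<Rightarrow> complex) \<Rightarrow> bool" where
  "slash_invariant k G f \<longleftrightarrow> (\<forall>\<gamma>\<in>G. \<forall>\<Omega>\<in>H2. slash k f \<gamma> \<Omega> = f \<Omega>)"

lemma slash_invariant_siegel_forms: "f \<in> siegel_forms k G \<Longrightarrow> slash_invariant k G f"
  by (simp add: siegel_forms_def slash_invariant_def)

lemma slash_invariant_mult:
  assumes "slash_invariant k G f" "G \<subseteq> SpR" "g \<in> G" "h \<in> SpR" "\<Omega> \<in> H2"
  shows "slash k f (g ** h) \<Omega> = slash k f h \<Omega>"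
proof -
  have "slash k f (g ** h) \<Omega> = slash k (slash k f g) h \<Omega>"
    using assms by (intro slash_mult[symmetric]) auto
  also have "\<dots> = slash k f h \<Omega>"
    using assms by (intro slash_cong) (auto simp: slash_invariant_def)
  finally show ?thesis .
qed

text \<open>Frees \<open>hecke_act\<close> on invariant functions from the arbitrary choice of
  representatives in its definition.\<close>

lemma slash_coset_rep:
  assumes "matrix_group G" "slash_invariant k G f" "G \<subseteq> SpR" "h \<in> SpR" "\<Omega> \<in> H2"
  shows "slash k f (coset_rep (coset G h)) \<Omega> = slash k f h \<Omega>"
  using coset_rep_coset[OF assms(1), of h] slash_invariant_mult[OF assms(2,3) _ assms(4,5)]
  by metis

lemma hecke_act_double_coset:
  assumes G: "matrix_group G" and inv: "slash_invariant k G f" and "G \<subseteq> SpR" "K \<subseteq> SpR"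
    and r: "bij_betw (\<lambda>i. coset G (r i)) I (coset G ` K)" "r ` I \<subseteq> K" and "\<Omega> \<in> H2"
  shows "hecke_act k f (double_coset G (mat 1) K) \<Omega> = (\<Sum>i\<in>I. slash k f (r i) \<Omega>)"
proof -
  have "hecke_act k f (double_coset G (mat 1) K) \<Omega> = (\<Sum>c\<in>coset G ` K. slash k f (coset_rep c) \<Omega>)"
    by (simp add: hecke_act_def double_coset_one_eq[OF G] hecke_supp_of_bool)
  also have "\<dots> = (\<Sum>i\<in>I. slash k f (coset_rep (coset G (r i))) \<Omega>)"
    by (rule sum.reindex_bij_betw[OF r(1), symmetric])
  also have "\<dots> = (\<Sum>i\<in>I. slash k f (r i) \<Omega>)"
    using assms by (intro sum.cong refl slash_coset_rep[OF G inv]) auto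
  finally show ?thesis .
qed

text \<open>Right translation by an element of \<open>K\<close> permutes the cosets, so it merely
  replaces one system of representatives by another and leaves the sum unchanged.\<close>

lemma hecke_act_slash_invariant:
  assumes G: "matrix_group G" and K: "matrix_group K" and inv: "slash_invariant k G f"
    and "G \<subseteq> SpR" "K \<subseteq> SpR"
    and r: "bij_betw (\<lambda>i. coset G (r i)) I (coset G ` K)" "r ` I \<subseteq> K"
  shows "slash_invariant k K (hecke_act k f (double_coset G (mat 1) K))"
  unfolding slash_invariant_def
proof (intro ballI)
  fix \<gamma> \<Omega> assume \<gamma>: "\<gamma> \<in> K" and \<Omega>: "\<Omega> \<in> H2"
  let ?g = "hecke_act k f (double_coset G (mat 1) K)"
  note act = hecke_act_double_coset[OF G inv assms(4,5)]
  have rS: "r i \<in> SpR" if "i \<in> I" for i using that r assms by auto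
  have \<gamma>S: "\<gamma> \<in> SpR" using \<gamma> assms by auto
  obtain \<delta> where \<delta>: "\<delta> \<in> K" "\<delta> ** \<gamma> = mat 1" "\<gamma> ** \<delta> = mat 1" using matrix_group_inverse[OF K \<gamma>] .
  have "bij_betw (\<lambda>c. (\<lambda>x. x ** \<gamma>) ` c) (coset G ` K) (coset G ` K)"
  proof (rule bij_betwI[where g = "\<lambda>c. (\<lambda>x. x ** \<delta>) ` c"])
    show "(`) (\<lambda>x. x ** \<gamma>) \<in> coset G ` K \<rightarrow> coset G ` K"
      "(`) (\<lambda>x. x ** \<delta>) \<in> coset G ` K \<rightarrow> coset G ` K"
      using \<gamma> \<delta>(1) matrix_group_mult[OF K] by (auto simp: coset_mult_right)
  qed (auto simp: image_image matrix_mul_assoc[symmetric] \<delta>)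
  from bij_betw_trans[OF r(1) this]
  have bij: "bij_betw (\<lambda>i. coset G (r i ** \<gamma>)) I (coset G ` K)"
    by (simp add: comp_def coset_mult_right)
  have "slash k ?g \<gamma> \<Omega> = slash k (\<lambda>\<Omega>. \<Sum>i\<in>I. slash k f (r i) \<Omega>) \<gamma> \<Omega>"
    by (intro slash_cong \<gamma>S \<Omega> act[OF r])
  also have "\<dots> = (\<Sum>i\<in>I. slash k f (r i ** \<gamma>) \<Omega>)"
    using rS \<gamma>S \<Omega> by (simp add: slash_sum slash_mult)
  also have "\<dots> = ?g \<Omega>"
    using r(2) \<gamma> matrix_group_mult[OF K] by (intro act[OF bij _ \<Omega>, symmetric]) auto
  finally show "slash k ?g \<gamma> \<Omega> = ?g \<Omega>" .
qed

lemma hecke_act_siegel_forms: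
  assumes G: "matrix_group G" and K: "matrix_group K" and f: "f \<in> siegel_forms k G"
    and "G \<subseteq> SpR" "K \<subseteq> SpR"
    and r: "bij_betw (\<lambda>i. coset G (r i)) I (coset G ` K)" "r ` I \<subseteq> K"
  shows "hecke_act k f (double_coset G (mat 1) K) \<in> siegel_forms k K"
proof -
  let ?g = "hecke_act k f (double_coset G (mat 1) K)"
  have f': "holomorphic_on_H2 f" "slash_invariant k G f"
    using f by (auto simp: siegel_forms_def slash_invariant_def)
  have "holomorphic_on_H2 (\<lambda>\<Omega>. \<Sum>i\<in>I. slash k f (r i) \<Omega>)"
    using r assms(5) by (intro holomorphic_on_H2_sum holomorphic_on_H2_slash[OF f'(1)]) auto
  then have "holomorphic_on_H2 ?g"
    by (rule holomorphic_on_H2_cong) (simp add: hecke_act_double_coset[OF G f'(2) assms(4,5) r])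
  then show ?thesis
    using hecke_act_slash_invariant[OF G K f'(2) assms(4,5) r]
    by (simp add: siegel_forms_def slash_invariant_def)
qed


section \<open>Coset representatives for the level \<open>p\<close> groups\<close>

text \<open>In blocks this is (D', -B'; -C', A'), the inverse of a symplectic matrix. Its entries
  are those of \<open>g\<close> up to place and sign, so congruence conditions can be read off
  directly.\<close>

definition sp_inv :: "mat4 \<Rightarrow> mat4" where
  "sp_inv g = mat_rows
    [[  g$3$3,   g$4$3, - g$1$3, - g$2$3],
     [  g$3$4,   g$4$4, - g$1$4, - g$2$4],
     [- g$3$1, - g$4$1,   g$1$1,   g$2$1],
     [- g$3$2, - g$4$2,   g$1$2,   g$2$2]]"

lemma sp_inv_inverse:
  assumes "g \<in> SpR"
  shows "sp_inv g ** g = mat 1" "g ** sp_inv g = mat 1"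
proof -
  show "sp_inv g ** g = mat 1"
    using assms[unfolded SpR_iff]
    by (simp add: sp_inv_def mat4_simps mat_def algebra_simps)
  then show "g ** sp_inv g = mat 1" by (simp add: matrix_left_right_inverse)
qed

lemma sp_inv_SpR:
  assumes "g \<in> SpR"
  shows "sp_inv g \<in> SpR"
proof -
  let ?h = "sp_inv g"
  have J: "transpose g ** Jmat ** g = Jmat" using assms by (simp add: SpR_def)
  have "transpose ?h ** transpose g = mat 1"
    by (simp add: matrix_transpose_mul[symmetric] sp_inv_inverse[OF assms])
  then have "transpose ?h ** (transpose g ** Jmat ** g) ** ?h = Jmat ** (g ** ?h)"
    by (simp add: matrix_mul_assoc)
  then show ?thesis by (simp add: J SpR_def sp_inv_inverse[OF assms])
qed

lemma entry_pattern_iff: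
  assumes "\<And>i j. S$i$j \<noteq> 0"
  shows "g \<in> entry_pattern S \<longleftrightarrow> (\<forall>i j. g$i$j / S$i$j \<in> \<int>)"
proof -
  have "(\<exists>n::int. g$i$j = S$i$j * of_int n) \<longleftrightarrow> g$i$j / S$i$j \<in> \<int>" for i j
    using assms[of i j] by (auto simp: field_simps elim!: Ints_cases)
  then show ?thesis by (simp add: entry_pattern_def)
qed

text \<open>The condition \<open>mult\<close> makes each summand of a matrix product an integral
  multiple of \<open>S$i$j\<close>, and the six equalities \<open>inv\<close> say that the
  rearrangement of entries in \<open>sp_inv\<close> respects the pattern.\<close>

lemma matrix_group_pattern:
  assumes nz: "\<And>i j. S$i$j \<noteq> 0"
    and one: "\<And>i. 1 / S$i$i \<in> \<int>"
    and mult: "\<And>i j k. S$i$k * S$k$j / S$i$j \<in> \<int>"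
    and inv: "S$3$3 = S$1$1" "S$4$4 = S$2$2" "S$4$3 = S$1$2" "S$3$4 = S$2$1" "S$2$3 = S$1$4"
      "S$4$1 = S$3$2"
  shows "matrix_group (SpR \<inter> entry_pattern S)"
  unfolding matrix_group_def
proof (intro conjI ballI)
  have "mat 1 \<in> entry_pattern S"
    using one by (auto simp: entry_pattern_iff[OF nz] mat_def)
  moreover have "(mat 1 :: mat4) \<in> SpR" by (simp add: SpR_def)
  ultimately show "mat 1 \<in> SpR \<inter> entry_pattern S" by simp
next
  fix g h assume gh: "g \<in> SpR \<inter> entry_pattern S" "h \<in> SpR \<inter> entry_pattern S"
  have "(g ** h) $ i $ j / S$i$j \<in> \<int>" for i j
  proof -
    have "(g ** h) $ i $ j / S$i$j = (\<Sum>k\<in>UNIV. g$i$k * h$k$j / S$i$j)"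
      by (simp add: matrix_matrix_mult_def sum_divide_distrib)
    also have "\<dots> = (\<Sum>k\<in>UNIV. (g$i$k / S$i$k) * (h$k$j / S$k$j) * (S$i$k * S$k$j / S$i$j))"
      using nz by (intro sum.cong) auto
    also have "\<dots> \<in> \<int>"
      using gh mult by (intro Ints_sum Ints_mult) (auto simp: entry_pattern_iff[OF nz])
    finally show ?thesis .
  qed
  then show "g ** h \<in> SpR \<inter> entry_pattern S"
    using gh SpR_mult by (auto simp: entry_pattern_iff[OF nz])
next
  fix g assume g: "g \<in> SpR \<inter> entry_pattern S"
  then have "sp_inv g \<in> entry_pattern S"
    by (simp add: entry_pattern_iff[OF nz] forall_4 sp_inv_def mat_rows_def inv)
  then show "\<exists>h\<in>SpR \<inter> entry_pattern S. h ** g = mat 1 \<and> g ** h = mat 1"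
    using g sp_inv_inverse sp_inv_SpR by (intro bexI[of _ "sp_inv g"]) auto
qed

lemma
  assumes "p > 0"
  shows paramodular_iff: "g \<in> paramodular p \<longleftrightarrow> g \<in> SpR \<and>
    g$1$1 \<in> \<int> \<and> g$1$2 \<in> \<int> \<and> g$1$3 * p \<in> \<int> \<and> g$1$4 \<in> \<int> \<and>
    g$2$1 / p \<in> \<int> \<and> g$2$2 \<in> \<int> \<and> g$2$3 \<in> \<int> \<and> g$2$4 \<in> \<int> \<and>
    g$3$1 / p \<in> \<int> \<and> g$3$2 / p \<in> \<int> \<and> g$3$3 \<in> \<int> \<and> g$3$4 / p \<in> \<int> \<and>
    g$4$1 / p \<in> \<int> \<and> g$4$2 \<in> \<int> \<and> g$4$3 \<in> \<int> \<and> g$4$4 \<in> \<int>" (is "_ \<longleftrightarrow> _ \<and> ?I")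
  and matrix_group_paramodular: "matrix_group (paramodular p)"
proof -
  define S :: mat4 where "S = mat_rows
    [[     1,      1, 1 / real p,      1],
     [real p,      1,          1,      1],
     [real p, real p,          1, real p],
     [real p,      1,          1,      1]]"
  have S: "S$1$1 = 1" "S$1$2 = 1" "S$1$3 = 1 / p" "S$1$4 = 1"
    "S$2$1 = p" "S$2$2 = 1" "S$2$3 = 1" "S$2$4 = 1"
    "S$3$1 = p" "S$3$2 = p" "S$3$3 = 1" "S$3$4 = p"
    "S$4$1 = p" "S$4$2 = 1" "S$4$3 = 1" "S$4$4 = 1"
    by (simp_all add: S_def mat_rows_def)
  have nz: "S$i$j \<noteq> 0" for i j
    using exhaust_4[of i] exhaust_4[of j] assms by (auto simp: S)
  have Q: "S$i$j \<in> \<rat>" for i j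
    using exhaust_4[of i] exhaust_4[of j] by (auto simp: S)
  \<comment> \<open>The pattern already forces rational entries, so \<open>Sp2Q\<close> may be
    replaced by \<open>SpR\<close>.\<close>
  have "g$i$j \<in> \<rat>" if g: "g \<in> entry_pattern S" for g i j
  proof -
    obtain n where "g$i$j = S$i$j * of_int n" using g by (auto simp: entry_pattern_def)
    then show ?thesis using Q by simp
  qed
  then have P: "paramodular p = SpR \<inter> entry_pattern S"
    by (auto simp: paramodular_def Sp2Q_def SpR_def S_def)
  show "g \<in> paramodular p \<longleftrightarrow> g \<in> SpR \<and> ?I"
    by (simp add: P entry_pattern_iff[OF nz] forall_4 S)
  show "matrix_group (paramodular p)"
    unfolding P
  proof (rule matrix_group_pattern)
    show "1 / S$i$i \<in> \<int>" for i using exhaust_4[of i] by (auto simp: S)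
    have "\<forall>i j k. S$i$k * S$k$j / S$i$j \<in> \<int>" using assms by (simp add: forall_4 S)
    then show "S$i$k * S$k$j / S$i$j \<in> \<int>" for i j k by blast
  qed (simp_all add: nz S)
qed

lemma Sp2Z_iff: "g \<in> Sp2Z \<longleftrightarrow> g \<in> SpR \<and> (\<forall>i j. g$i$j \<in> \<int>)"
  by (simp add: Sp2Z_def SpR_def)

lemma
  assumes "p > 0"
  shows Gamma0_iff: "g \<in> Gamma0 p \<longleftrightarrow> g \<in> SpR \<and>
    g$1$1 \<in> \<int> \<and> g$1$2 \<in> \<int> \<and> g$1$3 \<in> \<int> \<and> g$1$4 \<in> \<int> \<and>
    g$2$1 \<in> \<int> \<and> g$2$2 \<in> \<int> \<and> g$2$3 \<in> \<int> \<and> g$2$4 \<in> \<int> \<and>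
    g$3$1 / p \<in> \<int> \<and> g$3$2 / p \<in> \<int> \<and> g$3$3 \<in> \<int> \<and> g$3$4 \<in> \<int> \<and>
    g$4$1 / p \<in> \<int> \<and> g$4$2 / p \<in> \<int> \<and> g$4$3 \<in> \<int> \<and> g$4$4 \<in> \<int>" (is "_ \<longleftrightarrow> _ \<and> ?I")
  and matrix_group_Gamma0: "matrix_group (Gamma0 p)"
proof -
  define S :: mat4 where "S = mat_rows
    [[     1,      1, 1, 1],
     [     1,      1, 1, 1],
     [real p, real p, 1, 1],
     [real p, real p, 1, 1]]"
  have S: "S$1$1 = 1" "S$1$2 = 1" "S$1$3 = 1" "S$1$4 = 1"
    "S$2$1 = 1" "S$2$2 = 1" "S$2$3 = 1" "S$2$4 = 1"
    "S$3$1 = p" "S$3$2 = p" "S$3$3 = 1" "S$3$4 = 1"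
    "S$4$1 = p" "S$4$2 = p" "S$4$3 = 1" "S$4$4 = 1"
    by (simp_all add: S_def mat_rows_def)
  have nz: "S$i$j \<noteq> 0" for i j
    using exhaust_4[of i] exhaust_4[of j] assms by (auto simp: S)
  have Q: "S$i$j \<in> \<int>" for i j
    using exhaust_4[of i] exhaust_4[of j] by (auto simp: S)
  have "g$i$j \<in> \<int>" if g: "g \<in> entry_pattern S" for g i j
  proof -
    obtain n where "g$i$j = S$i$j * of_int n" using g by (auto simp: entry_pattern_def)
    then show ?thesis using Q by simp
  qed
  then have P: "Gamma0 p = SpR \<inter> entry_pattern S"
    by (auto simp: Gamma0_def Sp2Z_def SpR_def S_def)
  show "g \<in> Gamma0 p \<longleftrightarrow> g \<in> SpR \<and> ?I"
    by (simp add: P entry_pattern_iff[OF nz] forall_4 S)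
  show "matrix_group (Gamma0 p)"
    unfolding P
  proof (rule matrix_group_pattern)
    show "1 / S$i$i \<in> \<int>" for i using exhaust_4[of i] by (auto simp: S)
    have "\<forall>i j k. S$i$k * S$k$j / S$i$j \<in> \<int>" using assms by (simp add: forall_4 S)
    then show "S$i$k * S$k$j / S$i$j \<in> \<int>" for i j k by blast
  qed (simp_all add: nz S)
qed

lemma Ints_divide_of_nat_imp: "x / real p \<in> \<int> \<Longrightarrow> p > 0 \<Longrightarrow> x \<in> \<int>"
  using Ints_mult[of "x / real p" "real p"] by simp

text \<open>Only the place (1,3) of the paramodular pattern admits a denominator.\<close>

lemma Gamma0'_iff:
  assumes "p > 0"
  shows "g \<in> Gamma0' p \<longleftrightarrow> g \<in> paramodular p \<and> g$1$3 \<in> \<int>"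
  using assms
  by (auto simp: Gamma0'_def Sp2Z_iff forall_4 paramodular_iff dest: Ints_divide_of_nat_imp)

text \<open>The places where \<open>Bgrp\<close> demands divisibility by p are exactly those where
  \<open>Gamma0\<close> or \<open>Gamma0'\<close> demands it.\<close>

lemma Bgrp_eq:
  assumes "p > 0"
  shows "Bgrp p = Gamma0 p \<inter> Gamma0' p"
proof -
  define S :: mat4 where "S = mat_rows
    [[     1,      1, 1,      1],
     [real p,      1, 1,      1],
     [real p, real p, 1, real p],
     [real p, real p, 1,      1]]"
  have S: "S$1$1 = 1" "S$1$2 = 1" "S$1$3 = 1" "S$1$4 = 1"
    "S$2$1 = p" "S$2$2 = 1" "S$2$3 = 1" "S$2$4 = 1"
    "S$3$1 = p" "S$3$2 = p" "S$3$3 = 1" "S$3$4 = p"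
    "S$4$1 = p" "S$4$2 = p" "S$4$3 = 1" "S$4$4 = 1"
    by (simp_all add: S_def mat_rows_def)
  have nz: "S$i$j \<noteq> 0" for i j
    using exhaust_4[of i] exhaust_4[of j] assms by (auto simp: S)
  have P: "Bgrp p = Sp2Z \<inter> entry_pattern S" by (simp add: Bgrp_def S_def)
  show ?thesis
    unfolding P using assms
    by (auto simp: set_eq_iff entry_pattern_iff[OF nz] forall_4 S Sp2Z_iff Gamma0_iff
        Gamma0'_iff paramodular_iff dest: Ints_divide_of_nat_imp)
qed

text \<open>The congruence at place (4,2) is the only one of \<open>Bgrp\<close> that
  \<open>Gamma0'\<close> does not imply, so a single entry detects its cosets.\<close>

lemma Bgrp_iff:
  assumes "p > 0"
  shows "g \<in> Bgrp p \<longleftrightarrow> g \<in> Gamma0' p \<and> g$4$2 / p \<in> \<int>"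
  using assms
  by (auto simp: Bgrp_eq Gamma0_iff Gamma0'_iff paramodular_iff dest: Ints_divide_of_nat_imp)

lemma matrix_group_Sp2Z: "matrix_group Sp2Z"
proof -
  have "Sp2Z = Gamma0 1" by (auto simp: Sp2Z_iff Gamma0_iff forall_4)
  then show ?thesis using matrix_group_Gamma0[of 1] by simp
qed

lemma matrix_group_Gamma0': "p > 0 \<Longrightarrow> matrix_group (Gamma0' p)"
  unfolding Gamma0'_def by (intro matrix_group_Int matrix_group_Sp2Z matrix_group_paramodular)

lemma matrix_group_Bgrp: "p > 0 \<Longrightarrow> matrix_group (Bgrp p)"
  by (simp add: Bgrp_eq matrix_group_Int matrix_group_Gamma0' matrix_group_Gamma0)

section \<open>Equality of cosets as a congruence\<close>

lemma coset_eq_iff_sp_inv: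
  assumes "matrix_group G" "y \<in> SpR"
  shows "coset G x = coset G y \<longleftrightarrow> x ** sp_inv y \<in> G"
proof -
  have "x ** sp_inv y = h" if "x = h ** y" for h
    by (simp add: that matrix_mul_assoc[symmetric] sp_inv_inverse[OF assms(2)])
  moreover have "x = (x ** sp_inv y) ** y"
    by (simp add: matrix_mul_assoc[symmetric] sp_inv_inverse[OF assms(2)])
  ultimately show ?thesis using coset_eq_iff[OF assms(1)] by metis
qed

lemma sp_inv_mem:
  assumes "matrix_group G" "G \<subseteq> SpR" "g \<in> G"
  shows "sp_inv g \<in> G"
proof -
  obtain h where h: "h \<in> G" "h ** g = mat 1" using matrix_group_inverse[OF assms(1,3)] by metis
  have "h = sp_inv g"
    using sp_inv_inverse(2)[of g] assms h by (metis matrix_mul_assoc matrix_mul_lid matrix_mul_rid subsetD)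
  then show ?thesis using h by simp
qed

lemma paramodular_SpR: "p > 0 \<Longrightarrow> paramodular p \<subseteq> SpR"
  by (auto simp: paramodular_iff)

lemma Gamma0'_paramodular: "Gamma0' p \<subseteq> paramodular p"
  by (auto simp: Gamma0'_def)

text \<open>The numerator is entry (4,2) of \<open>x ** sp_inv y\<close>. Entries (4,1) are
  divisible by p, so the condition is the vanishing modulo p of the determinant of the pairs at
  (4,2), (4,4): equality of points on the projective line when p is prime.\<close>

lemma coset_Bgrp_eq_iff:
  assumes "p > 0" "x \<in> Gamma0' p" "y \<in> Gamma0' p"
  shows "coset (Bgrp p) x = coset (Bgrp p) y \<longleftrightarrow>
    (x$4$1 * y$4$3 + x$4$2 * y$4$4 - x$4$3 * y$4$1 - x$4$4 * y$4$2) / p \<in> \<int>"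
proof -
  have sub: "Gamma0' p \<subseteq> SpR" using assms Gamma0'_paramodular paramodular_SpR by blast
  then have "x ** sp_inv y \<in> Gamma0' p"
    using assms matrix_group_Gamma0' sp_inv_mem matrix_group_mult by metis
  moreover have "(x ** sp_inv y) $ 4 $ 2 = x$4$1 * y$4$3 + x$4$2 * y$4$4 - x$4$3 * y$4$1 - x$4$4 * y$4$2"
    by (simp add: matrix_matrix_mult_def sum_4 sp_inv_def mat_rows_def)
  ultimately show ?thesis
    using assms sub by (subst coset_eq_iff_sp_inv) (auto simp: matrix_group_Bgrp Bgrp_iff)
qed

text \<open>The expression is entry (1,3) of \<open>x ** sp_inv y\<close>. Its terms with columns 2
  and 4 are integral, so the condition compares the pairs formed by entry (1,1) and p times entry
  (1,3), modulo p.\<close>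

lemma coset_Gamma0'_eq_iff:
  assumes "p > 0" "x \<in> paramodular p" "y \<in> paramodular p"
  shows "coset (Gamma0' p) x = coset (Gamma0' p) y \<longleftrightarrow>
    x$1$3 * y$1$1 + x$1$4 * y$1$2 - x$1$1 * y$1$3 - x$1$2 * y$1$4 \<in> \<int>"
proof -
  have sub: "paramodular p \<subseteq> SpR" using assms paramodular_SpR by blast
  then have "x ** sp_inv y \<in> paramodular p"
    using assms matrix_group_paramodular sp_inv_mem matrix_group_mult by metis
  moreover have "(x ** sp_inv y) $ 1 $ 3 = x$1$3 * y$1$1 + x$1$4 * y$1$2 - x$1$1 * y$1$3 - x$1$2 * y$1$4"
    by (simp add: matrix_matrix_mult_def sum_4 sp_inv_def mat_rows_def)
  ultimately show ?thesis
    using assms sub by (subst coset_eq_iff_sp_inv) (auto simp: matrix_group_Gamma0' Gamma0'_iff)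
qed

section \<open>Arithmetic modulo p\<close>

lemma prime_linear_solve:
  fixes c d :: int
  assumes "prime p" "\<not> int p dvd c"
  shows "\<exists>\<alpha><p. int p dvd d - int \<alpha> * c"
proof -
  have "coprime (int p) c" using assms by (simp add: prime_imp_coprime)
  then obtain u v where uv: "u * int p + v * c = 1"
    using bezout_int[of "int p" c] by (auto simp: coprime_iff_gcd_eq_1)
  \<comment> \<open>By Bezout \<open>v\<close> inverts \<open>c\<close> modulo p, so
    \<open>v * d\<close> solves the congruence; reduction brings it into the range of indices below
    p.\<close>
  define \<alpha> where "\<alpha> = nat ((v * d) mod int p)"
  have p0: "p > 0" using assms prime_gt_0_nat by blast
  then have \<alpha>: "int \<alpha> = (v * d) mod int p" "\<alpha> < p"
    by (auto simp: \<alpha>_def nat_less_iff)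
  have "d - int \<alpha> * c = int p * (u * d + ((v * d) div int p) * c)"
  proof -
    have "int \<alpha> = v * d - int p * ((v * d) div int p)"
      by (simp add: \<alpha>(1) minus_mult_div_eq_mod)
    then have "d - int \<alpha> * c = d * (1 - v * c) + int p * ((v * d) div int p) * c"
      by (simp only: left_diff_distrib right_diff_distrib mult.assoc mult_1_right mult.left_commute[of d v])
    also have "1 - v * c = u * int p" using uv by simp
    finally show ?thesis by (simp add: algebra_simps)
  qed
  then show ?thesis using \<alpha>(2) by auto
qed

lemma of_int_divide_of_nat_Ints_iff:
  assumes "p > 0"
  shows "real_of_int n / real p \<in> \<int> \<longleftrightarrow> int p dvd n"
proof
  assume "real_of_int n / real p \<in> \<int>"
  then obtain m where "real_of_int n / real p = of_int m" by (auto elim: Ints_cases)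
  then have "real_of_int n = of_int (int p * m)" using assms by (simp add: field_simps)
  then show "int p dvd n" by (metis dvd_triv_left of_int_eq_iff)
qed (use assms in \<open>auto elim!: dvdE\<close>)

lemma diff_of_nat_divide_Ints_imp:
  assumes "(real i - real j) / real p \<in> \<int>" "i < p" "j < p"
  shows "i = j"
proof -
  have "int p dvd int i - int j"
    using of_int_divide_of_nat_Ints_iff[of p "int i - int j"] assms by simp
  moreover have "\<bar>int i - int j\<bar> < int p" using assms by auto
  ultimately show ?thesis using zdvd_not_zless[of "\<bar>int i - int j\<bar>" "int p"] by force
qed

text \<open>An element of K(p) outside \<open>Gamma0'\<close>. Its vanishing entry (1,1) makes it
  the representative of the point at infinity for the coordinates 1 and 3.\<close>

definition w_mat :: "nat \<Rightarrow> mat4" where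
  "w_mat p = mat_rows
    [[       0, 0, 1 / real p, 0],
     [       0, 1,          0, 0],
     [- real p, 0,          0, 0],
     [       0, 0,          0, 1]]"

text \<open>A block-diagonal element of every \<open>Gamma0 p\<close> that exchanges the coordinates
  1 and 2 up to sign. It is the discrepancy between the matrices of the trace formula and the
  products of representatives.\<close>

definition P_mat :: mat4 where
  "P_mat = mat_rows
    [[ 0, 1,  0, 0],
     [-1, 0,  0, 0],
     [ 0, 0,  0, 1],
     [ 0, 0, -1, 0]]"

abbreviation (input) t_diag :: "real \<Rightarrow> real \<Rightarrow> mat4" where
  "t_diag a b \<equiv> t_mat (mat_rows [[a, 0], [0, b]])"

text \<open>An index \<open>\<alpha> < p\<close> stands for the point where entry (4,4) is \<alpha>
  times entry (4,2) modulo p, the extra index p for the point where entry (4,2) vanishes modulo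
  p.\<close>

definition Bgrp_rep :: "nat \<Rightarrow> nat \<Rightarrow> mat4" where
  "Bgrp_rep p \<alpha> = (if \<alpha> = p then mat 1 else E1_mat ** t_diag 0 (real \<alpha>))"

text \<open>An index \<open>\<beta> < p\<close> stands for the point where p times entry (1,3) is
  \<beta> times entry (1,1) modulo p, the extra index p for the point where entry (1,1) vanishes
  modulo p.\<close>

definition Gamma0'_rep :: "nat \<Rightarrow> nat \<Rightarrow> mat4" where
  "Gamma0'_rep p \<beta> = (if \<beta> = p then w_mat p else t_diag (real \<beta> / real p) 0)"

lemma SpR_t_diag: "t_diag a b \<in> SpR"
  and SpR_E1: "E1_mat \<in> SpR"
  by (simp_all add: SpR_iff t_mat_def E1_mat_def mat_rows_def)

lemma SpR_mu_tilde: "p > 0 \<Longrightarrow> mu_tilde p \<in> SpR"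
  and SpR_w: "p > 0 \<Longrightarrow> w_mat p \<in> SpR"
  by (simp_all add: SpR_iff mu_tilde_def w_mat_def mat_rows_def)

lemma E1_t_diag:
  "E1_mat ** t_diag a b = mat_rows
    [[1,  0, a,  0],
     [0,  0, 0,  1],
     [0,  0, 1,  0],
     [0, -1, 0, -b]]"
  by (simp add: mat4_simps E1_mat_def t_mat_def)

lemma Bgrp_rep_mem: "p > 0 \<Longrightarrow> Bgrp_rep p \<alpha> \<in> Gamma0' p"
  using matrix_group_one[OF matrix_group_Gamma0'] SpR_mult[OF SpR_E1 SpR_t_diag, of 0 "real \<alpha>"]
  by (auto simp: Bgrp_rep_def Gamma0'_iff paramodular_iff E1_t_diag)
    (simp_all add: mat_rows_def)

lemma Gamma0'_rep_mem: "p > 0 \<Longrightarrow> Gamma0'_rep p \<beta> \<in> paramodular p"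
  using SpR_w SpR_t_diag[of "real \<beta> / real p" 0]
  by (auto simp: Gamma0'_rep_def paramodular_iff)
    (simp_all add: mat_rows_def w_mat_def t_mat_def)

lemma Bgrp_rep_row:
  "Bgrp_rep p p $ 4 $ 1 = 0" "Bgrp_rep p p $ 4 $ 2 = 0" "Bgrp_rep p p $ 4 $ 3 = 0"
  "Bgrp_rep p p $ 4 $ 4 = 1"
  "\<alpha> < p \<Longrightarrow> Bgrp_rep p \<alpha> $ 4 $ 1 = 0" "\<alpha> < p \<Longrightarrow> Bgrp_rep p \<alpha> $ 4 $ 2 = -1"
  "\<alpha> < p \<Longrightarrow> Bgrp_rep p \<alpha> $ 4 $ 3 = 0" "\<alpha> < p \<Longrightarrow> Bgrp_rep p \<alpha> $ 4 $ 4 = - real \<alpha>"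
  by (simp_all add: Bgrp_rep_def mat_def E1_t_diag) (simp_all add: mat_rows_def)

lemma Gamma0'_rep_row:
  "p > 0 \<Longrightarrow> Gamma0'_rep p p $ 1 $ 1 = 0" "p > 0 \<Longrightarrow> Gamma0'_rep p p $ 1 $ 2 = 0"
  "p > 0 \<Longrightarrow> Gamma0'_rep p p $ 1 $ 3 = 1 / p" "p > 0 \<Longrightarrow> Gamma0'_rep p p $ 1 $ 4 = 0"
  "\<beta> < p \<Longrightarrow> Gamma0'_rep p \<beta> $ 1 $ 1 = 1" "\<beta> < p \<Longrightarrow> Gamma0'_rep p \<beta> $ 1 $ 2 = 0"
  "\<beta> < p \<Longrightarrow> Gamma0'_rep p \<beta> $ 1 $ 3 = \<beta> / p" "\<beta> < p \<Longrightarrow> Gamma0'_rep p \<beta> $ 1 $ 4 = 0"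
  by (simp_all add: Gamma0'_rep_def w_mat_def t_mat_def mat_rows_def)

text \<open>Separates the index p from those below p, since the determinant for such a pair of
  points is 1 up to sign.\<close>

lemma one_divide_prime_notin_Ints: "prime p \<Longrightarrow> 1 / real p \<notin> \<int>"
  using of_int_divide_of_nat_Ints_iff[of p 1] prime_gt_0_nat[of p] prime_gt_1_nat[of p] by auto

lemma bij_betw_coset_Bgrp:
  assumes "prime p"
  shows "bij_betw (\<lambda>\<alpha>. coset (Bgrp p) (Bgrp_rep p \<alpha>)) {..p} (coset (Bgrp p) ` Gamma0' p)"
proof (rule bij_betw_imageI)
  have p0: "p > 0" using assms prime_gt_0_nat by blast
  note eq = coset_Bgrp_eq_iff[OF p0]
  show "inj_on (\<lambda>\<alpha>. coset (Bgrp p) (Bgrp_rep p \<alpha>)) {..p}"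
  proof (rule inj_onI)
    fix i j assume ij: "i \<in> {..p}" "j \<in> {..p}"
      "coset (Bgrp p) (Bgrp_rep p i) = coset (Bgrp p) (Bgrp_rep p j)"
    note e = ij(3)[unfolded eq[OF Bgrp_rep_mem[OF p0] Bgrp_rep_mem[OF p0]]]
    consider "i = p" "j = p" | "i = p" "j < p" | "i < p" "j = p" | "i < p" "j < p"
      using ij(1,2) by force
    then show "i = j"
    proof cases
      case 4
      then have "(real j - real i) / real p \<in> \<int>" using e by (simp add: Bgrp_rep_row)
      then show ?thesis using diff_of_nat_divide_Ints_imp 4 by metis
    qed (use e one_divide_prime_notin_Ints[OF assms] in \<open>auto simp: Bgrp_rep_row\<close>)
  qed
  have "coset (Bgrp p) g \<in> (\<lambda>\<alpha>. coset (Bgrp p) (Bgrp_rep p \<alpha>)) ` {..p}" if g: "g \<in> Gamma0' p" for g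
  proof -
    have "g$4$2 \<in> \<int>" "g$4$4 \<in> \<int>" using g p0 by (auto simp: Gamma0'_iff paramodular_iff)
    then obtain c d where cd: "g$4$2 = of_int c" "g$4$4 = of_int d" by (auto elim!: Ints_cases)
    have "\<exists>\<alpha>\<le>p. coset (Bgrp p) g = coset (Bgrp p) (Bgrp_rep p \<alpha>)"
    \<comment> \<open>For the index p the criterion is that p divides \<open>c\<close>. For smaller
      \<alpha> it is that p divides \<open>d - \<alpha> c\<close>, which is solvable once
      \<open>c\<close> is invertible modulo p.\<close>
    proof (cases "int p dvd c")
      case True
      then show ?thesis
        using of_int_divide_of_nat_Ints_iff[OF p0]
        by (intro exI[of _ p]) (simp add: eq[OF g Bgrp_rep_mem[OF p0]] Bgrp_rep_row cd)
    next
      case False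
      then obtain \<alpha> where \<alpha>: "\<alpha> < p" "int p dvd d - int \<alpha> * c"
        using prime_linear_solve[OF assms] by blast
      then show ?thesis
        using of_int_divide_of_nat_Ints_iff[OF p0, of "d - int \<alpha> * c"]
        by (intro exI[of _ \<alpha>])
          (simp add: eq[OF g Bgrp_rep_mem[OF p0]] Bgrp_rep_row cd algebra_simps)
    qed
    then show ?thesis by auto
  qed
  then show "(\<lambda>\<alpha>. coset (Bgrp p) (Bgrp_rep p \<alpha>)) ` {..p} = coset (Bgrp p) ` Gamma0' p"
    using Bgrp_rep_mem[OF p0] by blast
qed

lemma bij_betw_coset_Gamma0':
  assumes "prime p"
  shows "bij_betw (\<lambda>\<beta>. coset (Gamma0' p) (Gamma0'_rep p \<beta>)) {..p} (coset (Gamma0' p) ` paramodular p)"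
proof (rule bij_betw_imageI)
  have p0: "p > 0" using assms prime_gt_0_nat by blast
  note eq = coset_Gamma0'_eq_iff[OF p0] and mem = Gamma0'_rep_mem[OF p0] and row = Gamma0'_rep_row
  show "inj_on (\<lambda>\<beta>. coset (Gamma0' p) (Gamma0'_rep p \<beta>)) {..p}"
  proof (rule inj_onI)
    fix i j assume ij: "i \<in> {..p}" "j \<in> {..p}"
      "coset (Gamma0' p) (Gamma0'_rep p i) = coset (Gamma0' p) (Gamma0'_rep p j)"
    note e = ij(3)[unfolded eq[OF mem mem]]
    consider "i = p" "j = p" | "i = p" "j < p" | "i < p" "j = p" | "i < p" "j < p"
      using ij(1,2) by force
    then show "i = j"
    proof cases
      case 4
      then have "(real i - real j) / real p \<in> \<int>" using e by (simp add: row diff_divide_distrib)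
      then show ?thesis using diff_of_nat_divide_Ints_imp 4 by metis
    qed (use e p0 one_divide_prime_notin_Ints[OF assms] in \<open>auto simp: row\<close>)
  qed
  have "coset (Gamma0' p) g \<in> (\<lambda>\<beta>. coset (Gamma0' p) (Gamma0'_rep p \<beta>)) ` {..p}"
    if g: "g \<in> paramodular p" for g
  proof -
    have "g$1$1 \<in> \<int>" "g$1$3 * p \<in> \<int>" using g p0 by (auto simp: paramodular_iff)
    then obtain a b where "g$1$1 = of_int a" "g$1$3 * p = of_int b" by (auto elim!: Ints_cases)
    then have ab: "g$1$1 = of_int a" "g$1$3 = of_int b / p" using p0 by (auto simp: field_simps)
    have "\<exists>\<beta>\<le>p. coset (Gamma0' p) g = coset (Gamma0' p) (Gamma0'_rep p \<beta>)"
    proof (cases "int p dvd a")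
      case True
      then show ?thesis
        using of_int_divide_of_nat_Ints_iff[OF p0] p0
        by (intro exI[of _ p]) (simp add: eq[OF g mem] row ab)
    next
      case False
      then obtain \<beta> where \<beta>: "\<beta> < p" "int p dvd b - int \<beta> * a"
        using prime_linear_solve[OF assms] by blast
      then show ?thesis
        using of_int_divide_of_nat_Ints_iff[OF p0, of "b - int \<beta> * a"]
        by (intro exI[of _ \<beta>]) (simp add: eq[OF g mem] row ab diff_divide_distrib mult.commute)
    qed
    then show ?thesis by auto
  qed
  then show "(\<lambda>\<beta>. coset (Gamma0' p) (Gamma0'_rep p \<beta>)) ` {..p} = coset (Gamma0' p) ` paramodular p"
    using mem by blast
qed


section \<open>The trace operator\<close>

context
  fixes p :: nat
  assumes p: "prime p"
begin

lemma p_pos: "p > 0"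
  using p prime_gt_0_nat by blast

lemmas level_groups = matrix_group_Gamma0[OF p_pos] matrix_group_Bgrp[OF p_pos] matrix_group_Gamma0'[OF p_pos]
  matrix_group_paramodular[OF p_pos]

lemma Gamma0_SpR: "Gamma0 p \<subseteq> SpR"
  using p_pos by (auto simp: Gamma0_iff)

lemma Gamma0'_SpR: "Gamma0' p \<subseteq> SpR"
  using paramodular_SpR[OF p_pos] Gamma0'_paramodular by blast

lemma Bgrp_Gamma0: "Bgrp p \<subseteq> Gamma0 p"
  and Bgrp_Gamma0': "Bgrp p \<subseteq> Gamma0' p"
  and Gamma0_Int_paramodular: "Gamma0 p \<inter> paramodular p \<subseteq> Bgrp p"
  by (auto simp: Bgrp_eq[OF p_pos] Gamma0'_def Gamma0_def)

lemma finite_coset_Bgrp: "finite (coset (Bgrp p) ` Gamma0' p)"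
  using bij_betw_finite[OF bij_betw_coset_Bgrp[OF p]] by simp

lemma finite_coset_Gamma0': "finite (coset (Gamma0' p) ` paramodular p)"
  using bij_betw_finite[OF bij_betw_coset_Gamma0'[OF p]] by simp

lemmas bij_betw_coset_Gamma0 = bij_betw_coset_tower[OF level_groups Bgrp_Gamma0 Bgrp_Gamma0'
    Gamma0'_paramodular Gamma0_Int_paramodular bij_betw_coset_Bgrp[OF p] Bgrp_rep_mem[OF p_pos]
    bij_betw_coset_Gamma0'[OF p] Gamma0'_rep_mem[OF p_pos]]

lemma finite_coset_Gamma0: "finite (coset (Gamma0 p) ` paramodular p)"
  using bij_betw_finite[OF bij_betw_coset_Gamma0] by simp

text \<open>Two uses of \<open>hecke_mult_double_coset_one\<close>. The intersection of
  \<open>Gamma0 p\<close> with \<open>Gamma0' p\<close>, and then with \<open>paramodular p\<close>,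
  must lie in the middle group; both follow from \<open>Gamma0_Int_paramodular\<close>.\<close>

lemma Tr_hecke_eq: "Tr_hecke p = double_coset (Gamma0 p) (mat 1) (paramodular p)"
proof -
  \<comment> \<open>\<open>Gamma0 p\<close> absorbs \<open>Bgrp p\<close>, so the first factor has a
    single coset; this supplies the finiteness.\<close>
  have "coset (Gamma0 p) b = coset (Gamma0 p) (mat 1)" if "b \<in> Bgrp p" for b
    using that Bgrp_Gamma0 by (auto simp: coset_eq_iff[OF level_groups(1)])
  then have "coset (Gamma0 p) ` Bgrp p \<subseteq> {coset (Gamma0 p) (mat 1)}" by auto
  then have "finite (coset (Gamma0 p) ` Bgrp p)" by (rule finite_subset) simp
  then have "hecke_mult (double_coset (Gamma0 p) (mat 1) (Bgrp p))
      (double_coset (Bgrp p) (mat 1) (Gamma0' p)) = double_coset (Gamma0 p) (mat 1) (Gamma0' p)"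
    using Gamma0_Int_paramodular Gamma0'_paramodular
    by (intro hecke_mult_double_coset_one level_groups Bgrp_Gamma0' finite_coset_Bgrp) auto
  moreover have "finite (coset (Gamma0 p) ` Gamma0' p)"
    by (rule finite_coset_mono[OF level_groups(1,2) Bgrp_Gamma0 finite_coset_Bgrp])
  ultimately show ?thesis
    unfolding Tr_hecke_def
    using Gamma0_Int_paramodular Bgrp_Gamma0'
    by (simp add: hecke_mult_double_coset_one level_groups Gamma0'_paramodular finite_coset_Gamma0'
        order_trans)
qed

lemma siegel_forms_Bgrp: "f \<in> siegel_forms k (Gamma0 p) \<Longrightarrow> f \<in> siegel_forms k (Bgrp p)"
  using Bgrp_Gamma0 by (auto simp: siegel_forms_def)

text \<open>The second operator in \<open>Tr\<close> picks representatives arbitrarily, so its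
  argument must first be known to be invariant under \<open>Gamma0' p\<close>.\<close>

lemma trace_to_Gamma0':
  assumes "f \<in> siegel_forms k (Gamma0 p)"
  shows "hecke_act k f (double_coset (Bgrp p) (mat 1) (Gamma0' p)) \<in> siegel_forms k (Gamma0' p)"
  using Bgrp_Gamma0' Gamma0'_SpR Bgrp_rep_mem[OF p_pos]
  by (intro hecke_act_siegel_forms[OF level_groups(2,3) siegel_forms_Bgrp[OF assms] _ _ bij_betw_coset_Bgrp[OF p]])
    auto

lemma Tr_siegel_forms:
  assumes "f \<in> siegel_forms k (Gamma0 p)"
  shows "Tr k p f \<in> siegel_forms k (paramodular p)"
  unfolding Tr_def
  using Gamma0'_SpR paramodular_SpR[OF p_pos] Gamma0'_rep_mem[OF p_pos]
  by (intro hecke_act_siegel_forms[OF level_groups(3,4) trace_to_Gamma0'[OF assms] _ _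
        bij_betw_coset_Gamma0'[OF p]]) auto

text \<open>Both operators are evaluated on explicit representatives. As \<open>slash\<close> is a
  right action, the representative applied first stands on the left.\<close>

lemma Tr_eq_sum:
  assumes f: "f \<in> siegel_forms k (Gamma0 p)" and \<Omega>: "\<Omega> \<in> H2"
  shows "Tr k p f \<Omega> = (\<Sum>\<beta>\<le>p. \<Sum>\<alpha>\<le>p. slash k f (Bgrp_rep p \<alpha> ** Gamma0'_rep p \<beta>) \<Omega>)"
proof -
  let ?g = "hecke_act k f (double_coset (Bgrp p) (mat 1) (Gamma0' p))"
  have S: "Bgrp_rep p \<alpha> \<in> SpR" "Gamma0'_rep p \<beta> \<in> SpR" for \<alpha> \<beta>
    using Bgrp_rep_mem[OF p_pos] Gamma0'_rep_mem[OF p_pos] Gamma0'_SpR paramodular_SpR[OF p_pos] by auto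
  have g: "?g \<Omega> = (\<Sum>\<alpha>\<le>p. slash k f (Bgrp_rep p \<alpha>) \<Omega>)" if "\<Omega> \<in> H2" for \<Omega>
    using that Bgrp_Gamma0' Gamma0'_SpR Bgrp_rep_mem[OF p_pos]
    by (intro hecke_act_double_coset[OF level_groups(2) slash_invariant_siegel_forms[OF siegel_forms_Bgrp[OF f]]
          _ _ bij_betw_coset_Bgrp[OF p]]) auto
  have "Tr k p f \<Omega> = (\<Sum>\<beta>\<le>p. slash k ?g (Gamma0'_rep p \<beta>) \<Omega>)"
    unfolding Tr_def using \<Omega> Gamma0'_SpR paramodular_SpR[OF p_pos] Gamma0'_rep_mem[OF p_pos]
    by (intro hecke_act_double_coset[OF level_groups(3) slash_invariant_siegel_forms[OF trace_to_Gamma0'[OF f]]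
          _ _ bij_betw_coset_Gamma0'[OF p]]) auto
  also have "\<dots> = (\<Sum>\<beta>\<le>p. slash k (\<lambda>\<Omega>. \<Sum>\<alpha>\<le>p. slash k f (Bgrp_rep p \<alpha>) \<Omega>) (Gamma0'_rep p \<beta>) \<Omega>)"
    by (intro sum.cong refl slash_cong S \<Omega> g)
  also have "\<dots> = (\<Sum>\<beta>\<le>p. \<Sum>\<alpha>\<le>p. slash k f (Bgrp_rep p \<alpha> ** Gamma0'_rep p \<beta>) \<Omega>)"
    by (simp add: slash_sum S slash_mult \<Omega>)
  finally show ?thesis .
qed

text \<open>The products of representatives enumerate the cosets in \<open>Tr_hecke p\<close>, so it
  acts by the same double sum as the composite of the two operators.\<close>

lemma hecke_act_Tr_hecke:
  assumes f: "f \<in> siegel_forms k (Gamma0 p)" and \<Omega>: "\<Omega> \<in> H2"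
  shows "hecke_act k f (Tr_hecke p) \<Omega> = Tr k p f \<Omega>"
proof -
  have "hecke_act k f (Tr_hecke p) \<Omega> =
      (\<Sum>(\<beta>, \<alpha>)\<in>{..p} \<times> {..p}. slash k f (Bgrp_rep p \<alpha> ** Gamma0'_rep p \<beta>) \<Omega>)"
    unfolding Tr_hecke_eq split_def
  proof (rule hecke_act_double_coset[OF level_groups(1) slash_invariant_siegel_forms[OF f] Gamma0_SpR
        paramodular_SpR[OF p_pos] _ _ \<Omega>])
    show "bij_betw (\<lambda>i. coset (Gamma0 p) (Bgrp_rep p (snd i) ** Gamma0'_rep p (fst i)))
        ({..p} \<times> {..p}) (coset (Gamma0 p) ` paramodular p)"
      using bij_betw_coset_Gamma0 by (simp add: split_def)
    show "(\<lambda>i. Bgrp_rep p (snd i) ** Gamma0'_rep p (fst i)) ` ({..p} \<times> {..p}) \<subseteq> paramodular p"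
      using Bgrp_rep_mem[OF p_pos] Gamma0'_rep_mem[OF p_pos] Gamma0'_paramodular
      by (auto intro!: matrix_group_mult[OF level_groups(4)])
  qed
  then show ?thesis by (simp add: Tr_eq_sum[OF assms] sum.cartesian_product)
qed

section \<open>The matrices \<open>F_mat\<close> and \<open>mu_mat\<close> and their
  relations\<close>

lemma P_Gamma0: "P_mat \<in> Gamma0 p" "- P_mat \<in> Gamma0 p"
  by (simp_all add: Gamma0_iff[OF p_pos] SpR_iff P_mat_def mat_rows_def)

lemma F_nth:
  "F_mat p $ 1 $ 1 = 0" "F_mat p $ 1 $ 2 = 0" "F_mat p $ 1 $ 3 = 1 / sqrt p" "F_mat p $ 1 $ 4 = 0"
  "F_mat p $ 2 $ 1 = 0" "F_mat p $ 2 $ 2 = 0" "F_mat p $ 2 $ 3 = 0" "F_mat p $ 2 $ 4 = 1 / sqrt p"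
  "F_mat p $ 3 $ 1 = - sqrt p" "F_mat p $ 3 $ 2 = 0" "F_mat p $ 3 $ 3 = 0" "F_mat p $ 3 $ 4 = 0"
  "F_mat p $ 4 $ 1 = 0" "F_mat p $ 4 $ 2 = - sqrt p" "F_mat p $ 4 $ 3 = 0" "F_mat p $ 4 $ 4 = 0"
  by (simp_all add: F_mat_def mat_rows_def real_div_sqrt)

lemma mu_nth:
  "mu_mat p $ 1 $ 1 = 0" "mu_mat p $ 1 $ 2 = 1 / sqrt p" "mu_mat p $ 1 $ 3 = 0" "mu_mat p $ 1 $ 4 = 0"
  "mu_mat p $ 2 $ 1 = - sqrt p" "mu_mat p $ 2 $ 2 = 0" "mu_mat p $ 2 $ 3 = 0" "mu_mat p $ 2 $ 4 = 0"
  "mu_mat p $ 3 $ 1 = 0" "mu_mat p $ 3 $ 2 = 0" "mu_mat p $ 3 $ 3 = 0" "mu_mat p $ 3 $ 4 = sqrt p"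
  "mu_mat p $ 4 $ 1 = 0" "mu_mat p $ 4 $ 2 = 0" "mu_mat p $ 4 $ 3 = - 1 / sqrt p" "mu_mat p $ 4 $ 4 = 0"
  by (simp_all add: mu_mat_def mat_rows_def real_div_sqrt)

lemma SpR_F: "F_mat p \<in> SpR" "- F_mat p \<in> SpR"
  and SpR_mu: "mu_mat p \<in> SpR" "- mu_mat p \<in> SpR"
  using p_pos by (simp_all add: SpR_iff F_nth mu_nth)

text \<open>Both matrices square to -1, so their negatives are explicit inverses, and conjugation by
  the matrix or by its inverse is the same map.\<close>

lemma F_mu_square:
  "F_mat p ** - F_mat p = mat 1" "- F_mat p ** F_mat p = mat 1"
  "mu_mat p ** - mu_mat p = mat 1" "- mu_mat p ** mu_mat p = mat 1"
  using p_pos by (simp_all add: mat4_simps mat_def F_nth mu_nth)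

text \<open>Conjugation exchanges the blocks A and D and puts -C/p and -pB in place of B and C, so
  divisibility of C by p and integrality of B trade roles.\<close>

lemma normalizes_F: "normalizes (F_mat p) (Gamma0 p)"
proof -
  have "F_mat p ** g ** - F_mat p \<in> Gamma0 p" "- F_mat p ** g ** F_mat p \<in> Gamma0 p"
    if g: "g \<in> Gamma0 p" for g
  proof -
    have "F_mat p ** g ** - F_mat p \<in> SpR" "- F_mat p ** g ** F_mat p \<in> SpR"
      using g Gamma0_SpR SpR_F by (auto intro!: SpR_mult)
    moreover have "F_mat p ** g ** - F_mat p = - F_mat p ** g ** F_mat p"
      by (simp add: mat4_simps F_nth)
    moreover have "- F_mat p ** g ** F_mat p = mat_rows
      [[  g$3$3,   g$3$4, - g$3$1 / p, - g$3$2 / p],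
       [  g$4$3,   g$4$4, - g$4$1 / p, - g$4$2 / p],
       [- p * g$1$3, - p * g$1$4, g$1$1, g$1$2],
       [- p * g$2$3, - p * g$2$4, g$2$1, g$2$2]]"
      using p_pos by (simp add: mat4_simps F_nth)
    ultimately show "F_mat p ** g ** - F_mat p \<in> Gamma0 p" "- F_mat p ** g ** F_mat p \<in> Gamma0 p"
      using g p_pos by (simp_all add: Gamma0_iff[OF p_pos]) (auto simp: mat_rows_def dest: Ints_divide_of_nat_imp)
  qed
  then show ?thesis unfolding normalizes_def using F_mu_square by blast
qed

text \<open>Conjugation exchanges the coordinates 1, 3 with 2, 4 and rescales to fit the pattern:
  entry (2,4) divided by p lands at (1,3), the one place with denominators.\<close>

lemma normalizes_mu: "normalizes (mu_mat p) (paramodular p)"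
proof -
  have "mu_mat p ** g ** - mu_mat p \<in> paramodular p" "- mu_mat p ** g ** mu_mat p \<in> paramodular p"
    if g: "g \<in> paramodular p" for g
  proof -
    have "mu_mat p ** g ** - mu_mat p \<in> SpR" "- mu_mat p ** g ** mu_mat p \<in> SpR"
      using g paramodular_SpR[OF p_pos] SpR_mu by (auto intro!: SpR_mult)
    moreover have "mu_mat p ** g ** - mu_mat p = - mu_mat p ** g ** mu_mat p"
      by (simp add: mat4_simps mu_nth)
    moreover have "- mu_mat p ** g ** mu_mat p = mat_rows
      [[g$2$2, - g$2$1 / p, g$2$4 / p, - g$2$3],
       [- p * g$1$2, g$1$1, - g$1$4, p * g$1$3],
       [p * g$4$2, - g$4$1, g$4$4, - p * g$4$3],
       [- g$3$2, g$3$1 / p, - g$3$4 / p, g$3$3]]"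
      using p_pos by (simp add: mat4_simps mu_nth)
    ultimately show "mu_mat p ** g ** - mu_mat p \<in> paramodular p"
      "- mu_mat p ** g ** mu_mat p \<in> paramodular p"
      using g p_pos by (simp_all add: paramodular_iff[OF p_pos])
        (auto simp: mat_rows_def mult.commute dest: Ints_divide_of_nat_imp)
  qed
  then show ?thesis unfolding normalizes_def using F_mu_square by blast
qed

text \<open>Identifies the term with \<open>mu_tilde\<close>, up to the factor \<open>P_mat\<close>,
  as the representative with both indices equal to p.\<close>

lemma E1_mu_tilde: "E1_mat ** mu_tilde p = P_mat ** w_mat p"
  by (simp add: mat4_simps E1_mat_def mu_tilde_def P_mat_def w_mat_def)

text \<open>Serves twice: it identifies the last sum of the formula, and it expresses
  \<open>F_mat\<close> through \<open>mu_mat\<close> in the comparison of double cosets.\<close>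

lemma F_mu: "F_mat p ** mu_mat p = P_mat ** (E1_mat ** w_mat p)"
  using p_pos by (simp add: mat4_simps F_nth mu_nth E1_mat_def P_mat_def w_mat_def)

text \<open>The two matrices act on the complementary coordinate pairs 1, 3 and 2, 4.\<close>

lemma w_t_diag: "w_mat p ** t_diag 0 a = t_diag 0 a ** w_mat p"
  by (simp add: mat4_simps t_mat_def w_mat_def)

lemma t_diag_mult: "t_diag 0 a ** t_diag b 0 = t_diag b a"
  by (simp add: mat4_simps t_mat_def)

text \<open>The four terms are, in order, the index regions \<open>\<alpha> = p\<close>,
  \<open>\<beta> < p\<close>; both equal to p; both below p; \<open>\<alpha> < p\<close>,
  \<open>\<beta> = p\<close>. The factor \<open>P_mat\<close> disappears by invariance of
  \<open>f\<close>.\<close>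

lemma Tr_formula:
  assumes f: "f \<in> siegel_forms k (Gamma0 p)" and \<Omega>: "\<Omega> \<in> H2"
  shows "Tr k p f \<Omega> =
      (\<Sum>\<beta><p. slash k f (t_diag (real \<beta> / real p) 0) \<Omega>)
    + slash k (slash k f E1_mat) (mu_tilde p) \<Omega>
    + (\<Sum>\<alpha><p. \<Sum>\<beta><p. slash k (slash k f E1_mat) (t_diag (real \<beta> / real p) (real \<alpha>)) \<Omega>)
    + (\<Sum>\<alpha><p. slash k (slash k f (F_mat p)) (mu_mat p ** t_diag 0 (real \<alpha>)) \<Omega>)"
proof -
  note SpR_intros = SpR_mult SpR_E1 SpR_t_diag SpR_mu_tilde[OF p_pos] SpR_w[OF p_pos] SpR_F SpR_mu
  note inv = slash_invariant_mult[OF slash_invariant_siegel_forms[OF f] Gamma0_SpR P_Gamma0(1) _ \<Omega>]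
  have w: "slash k (slash k f E1_mat) (mu_tilde p) \<Omega> = slash k f (w_mat p) \<Omega>"
    by (simp add: slash_mult[OF _ _ \<Omega>] SpR_intros E1_mu_tilde inv)
  have t: "slash k (slash k f E1_mat) (t_diag b a) \<Omega> = slash k f (E1_mat ** t_diag 0 a ** t_diag b 0) \<Omega>"
    for a b
    by (simp add: slash_mult[OF _ _ \<Omega>] SpR_intros matrix_mul_assoc[symmetric] t_diag_mult)
  have F: "slash k (slash k f (F_mat p)) (mu_mat p ** t_diag 0 a) \<Omega> =
      slash k f (E1_mat ** t_diag 0 a ** w_mat p) \<Omega>" for a
  proof -
    have "F_mat p ** (mu_mat p ** t_diag 0 a) = P_mat ** (E1_mat ** (w_mat p ** t_diag 0 a))"
      using arg_cong[OF F_mu, of "\<lambda>x. x ** t_diag 0 a"] by (simp add: matrix_mul_assoc)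
    also have "\<dots> = P_mat ** (E1_mat ** t_diag 0 a ** w_mat p)"
      by (simp add: w_t_diag matrix_mul_assoc)
    finally show ?thesis by (simp add: slash_mult[OF _ _ \<Omega>] SpR_intros inv)
  qed
  let ?s = "\<lambda>\<beta> \<alpha>. slash k f (Bgrp_rep p \<alpha> ** Gamma0'_rep p \<beta>) \<Omega>"
  have "Tr k p f \<Omega> = (\<Sum>\<beta><p. (\<Sum>\<alpha><p. ?s \<beta> \<alpha>) + ?s \<beta> p) + ((\<Sum>\<alpha><p. ?s p \<alpha>) + ?s p p)"
    by (simp add: Tr_eq_sum[OF assms] lessThan_Suc_atMost[symmetric])
  also have "\<dots> = (\<Sum>\<beta><p. ?s \<beta> p) + ?s p p + (\<Sum>\<beta><p. \<Sum>\<alpha><p. ?s \<beta> \<alpha>) + (\<Sum>\<alpha><p. ?s p \<alpha>)"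
    by (simp add: sum.distrib)
  also have "(\<Sum>\<beta><p. \<Sum>\<alpha><p. ?s \<beta> \<alpha>) = (\<Sum>\<alpha><p. \<Sum>\<beta><p. ?s \<beta> \<alpha>)" by (rule sum.swap)
  finally show ?thesis by (simp add: w t F Bgrp_rep_def Gamma0'_rep_def)
qed

text \<open>The matrix \<open>E1_mat ** w_mat p\<close> lies in K(p) and can be moved across
  \<open>mu_mat p\<close>, which exhibits \<open>F_mat p\<close> as an element of
  \<open>Gamma0 p\<close> times \<open>mu_mat p\<close> times an element of K(p). The scalar
  \<open>c\<close> covers the normalisations 1 and sqrt p together.\<close>

lemma double_coset_scaled_F_mu:
  "double_coset (Gamma0 p) (c *\<^sub>R F_mat p) (paramodular p) =
   double_coset (Gamma0 p) (c *\<^sub>R mu_mat p) (paramodular p)"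
proof -
  have "E1_mat ** w_mat p \<in> paramodular p"
  proof -
    have "E1_mat ** w_mat p \<in> SpR" by (intro SpR_mult SpR_E1 SpR_w p_pos)
    then show ?thesis
      using p_pos by (simp add: paramodular_iff) (simp add: matrix_matrix_mult_def sum_4 E1_mat_def w_mat_def mat_rows_def)
  qed
  then obtain k where k: "k \<in> paramodular p" "E1_mat ** w_mat p ** mu_mat p = mu_mat p ** k"
    using normalizesE[OF normalizes_mu] by metis
  \<comment> \<open>Inserting \<open>mu_mat p\<close> and its inverse makes the product evaluated in
    \<open>F_mu\<close> appear.\<close>
  have "F_mat p = F_mat p ** (mu_mat p ** - mu_mat p)" by (simp add: F_mu_square)
  also have "\<dots> = P_mat ** (E1_mat ** w_mat p) ** - mu_mat p" by (simp add: matrix_mul_assoc F_mu)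
  also have "\<dots> = - P_mat ** (E1_mat ** w_mat p ** mu_mat p)"
    by (simp add: vec_eq_iff matrix_matrix_mult_def sum_4 algebra_simps)
  also have "\<dots> = - P_mat ** mu_mat p ** k" by (simp add: k(2) matrix_mul_assoc)
  finally have "c *\<^sub>R F_mat p = - P_mat ** (c *\<^sub>R mu_mat p) ** k"
    by (simp add: scalar_matrix_assoc matrix_scalar_ac)
  then show ?thesis using double_coset_cong[OF level_groups(1,4) P_Gamma0(2) k(1)] by simp
qed

end

text \<open>Multiplication by sqrt p clears the irrational factor and raises the multiplier to p,
  which places the scaled identity in the Hecke space over the rational similitude group
  itself.\<close>

lemma scaled_F_GSp2Q:
  assumes "p > 0"
  shows "sqrt p *\<^sub>R F_mat p \<in> GSp2Q"
proof -
  have e: "sqrt p *\<^sub>R F_mat p = mat_rows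
    [[       0,        0, 1, 0],
     [       0,        0, 0, 1],
     [- real p,        0, 0, 0],
     [       0, - real p, 0, 0]]"
    using assms by (simp add: F_mat_def)
  show ?thesis
    unfolding e GSp2Q_def GSp2R_def
    using assms by (simp add: mat4_simps Jmat_nth)
qed

lemma mat_1_GSp2Q: "mat 1 \<in> GSp2Q"
proof -
  have "(mat 1 :: mat4) $ i $ j \<in> \<rat>" for i j by (simp add: mat_def)
  then show ?thesis by (auto simp: GSp2Q_def GSp2R_def intro!: exI[of _ 1])
qed

theorem theorem3p2:
  fixes p :: nat and k :: int
  assumes "prime p"
  shows
    "(\<forall>f \<in> siegel_forms k (Gamma0 p).
        Tr k p f \<in> siegel_forms k (paramodular p) \<and>
        (\<forall>\<Omega>\<in>H2. hecke_act k f (Tr_hecke p) \<Omega> = Tr k p f \<Omega>) \<and>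
        (\<forall>\<Omega>\<in>H2. Tr k p f \<Omega> =
            (\<Sum>\<beta><p. slash k f (t_mat (mat_rows [[real \<beta> / real p, 0], [0, 0]])) \<Omega>)
          + slash k (slash k f E1_mat) (mu_tilde p) \<Omega>
          + (\<Sum>\<alpha><p. \<Sum>\<beta><p. slash k (slash k f E1_mat)
                (t_mat (mat_rows [[real \<beta> / real p, 0], [0, real \<alpha>]])) \<Omega>)
          + (\<Sum>\<alpha><p. slash k (slash k f (F_mat p))
                (mu_mat p ** t_mat (mat_rows [[0, 0], [0, real \<alpha>]])) \<Omega>)))
     \<and> Tr_hecke p \<in> hecke_space (Gamma0 p) GSp2Q (paramodular p)
     \<and> hecke_mult (single_coset (Gamma0 p) (F_mat p)) (Tr_hecke p)
         = hecke_mult (Tr_hecke p) (single_coset (paramodular p) (mu_mat p))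
     \<and> hecke_mult (single_coset (Gamma0 p) (F_mat p)) (Tr_hecke p)
         \<in> hecke_space (Gamma0 p) GSp2Q_scaled (paramodular p)
     \<and> hecke_mult (single_coset (Gamma0 p) (sqrt (real p) *\<^sub>R F_mat p)) (Tr_hecke p)
         = hecke_mult (Tr_hecke p) (single_coset (paramodular p) (sqrt (real p) *\<^sub>R mu_mat p))
     \<and> hecke_mult (single_coset (Gamma0 p) (sqrt (real p) *\<^sub>R F_mat p)) (Tr_hecke p)
         \<in> hecke_space (Gamma0 p) GSp2Q (paramodular p)"
proof -
  have p0: "p > 0" using assms prime_gt_0_nat by blast
  note level_groups = matrix_group_Gamma0[OF p0] matrix_group_paramodular[OF p0] and Tr = Tr_hecke_eq[OF assms]
  have F: "hecke_mult (single_coset (Gamma0 p) (c *\<^sub>R F_mat p)) (Tr_hecke p) =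
      double_coset (Gamma0 p) (c *\<^sub>R F_mat p) (paramodular p)" if "c \<noteq> 0" for c
    unfolding Tr using that
    by (intro hecke_mult_single_coset_left level_groups finite_coset_Gamma0 normalizes_scaleR
        normalizes_F assms)
  have mu: "hecke_mult (Tr_hecke p) (single_coset (paramodular p) (c *\<^sub>R mu_mat p)) =
      double_coset (Gamma0 p) (c *\<^sub>R mu_mat p) (paramodular p)" if "c \<noteq> 0" for c
    unfolding Tr using that
    by (intro hecke_mult_single_coset_right level_groups finite_coset_Gamma0 normalizes_scaleR
        normalizes_mu assms)
  have eq: "hecke_mult (single_coset (Gamma0 p) (c *\<^sub>R F_mat p)) (Tr_hecke p) =
      hecke_mult (Tr_hecke p) (single_coset (paramodular p) (c *\<^sub>R mu_mat p))" if "c \<noteq> 0" for c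
    using F[OF that] mu[OF that] double_coset_scaled_F_mu[OF assms] by simp
  have "F_mat p = (1 / sqrt p) *\<^sub>R (sqrt p *\<^sub>R F_mat p)" "1 / sqrt p > 0" using p0 by simp_all
  then have "F_mat p \<in> GSp2Q_scaled"
    unfolding GSp2Q_scaled_def using scaled_F_GSp2Q[OF p0] by blast
  then have "double_coset (Gamma0 p) (F_mat p) (paramodular p)
      \<in> hecke_space (Gamma0 p) GSp2Q_scaled (paramodular p)"
    by (rule double_coset_in_hecke_space)
  moreover have "double_coset (Gamma0 p) (sqrt p *\<^sub>R F_mat p) (paramodular p)
      \<in> hecke_space (Gamma0 p) GSp2Q (paramodular p)"
    by (intro double_coset_in_hecke_space scaled_F_GSp2Q p0)
  moreover have "Tr_hecke p \<in> hecke_space (Gamma0 p) GSp2Q (paramodular p)"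
    unfolding Tr by (intro double_coset_in_hecke_space mat_1_GSp2Q)
  ultimately show ?thesis
    using eq[of 1] eq[of "sqrt p"] F[of 1] F[of "sqrt p"] p0
      Tr_siegel_forms[OF assms] hecke_act_Tr_hecke[OF assms] Tr_formula[OF assms]
    by simp
qed

end
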